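(* Assume that for every integer $n\ge2$ and every real transcendental number $\zeta$ we have $\widehat w_n(\zeta)\le\phi_n(w_n(\zeta))$. Let $\tau\approx0.5693$ be the unique solution $y\in(0,1)$ of $y\,e^{1/y}=2\sqrt e$, and put $\Delta:=\log(2/\tau)+1\approx2.2564$. Then the following hold. (i) For every $\epsilon>0$ there exists $n_0=n_0(\epsilon)$ such that for all real transcendental $\zeta$ and all $n\ge n_0$ $$\widehat w_n^{*}(\zeta)\le 2n-\Delta+\epsilon.$$ (ii) Under the same quantifiers, $\widehat w_n(\zeta)\le 2n-\Delta+\epsilon$ holds as well, unless $w_{n-2}(\zeta)<w_{n-1}(\zeta)=w_n(\zeta)$. (iii) For all real transcendental $\zeta$ and all $n\ge10$, we have $\widehat w_n(\zeta)\le 2n-2$.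
   Context: Let $\zeta$ be real and $n\ge1$. For a polynomial $P\in\mathbb Z[X]$, $H(P)$ denotes its height, the maximum absolute value of its coefficients. - $w_n(\zeta)$ is the supremum of $\nu$ such that $|P(\zeta)|\le X^{-\nu}$ has a solution in nonzero $P\in\mathbb Z[X]$ with $\deg P\le n$ and $H(P)\le X$, for arbitrarily large $X$. - $\widehat w_n(\zeta)$ is the analogous supremum where a solution is required for all sufficiently large $X$. - For a real algebraic number $\alpha$, $H(\alpha)$ is the height of its irreducible minimal polynomial over $\mathbb Z$. - $\widehat w_n^{*}(\zeta)$ is the supremum of $\nu$ such that for all large $X$ there is a real algebraic $\alpha$ of degree at most $n$ with $H(\alpha)\le X$ and $0<|\zeta-\alpha|\le H(\alpha)^{-1}X^{-\nu}$. The function $\phi_n:[n,\infty]\to[n,\infty]$ (the relation between $\widehat w_n$ and $w_n$ in the Schmidt–Summerer regular graph) is defined as follows: - $\phi_n(n)=n$ and $\phi_n(\infty)=\infty$; - for $w\in(n,\infty)$, $\phi_n(w)$ is the unique solution $y\in[n,w)$ of $w-y+1=(w/y)^n$. $\phi_n$ is increasing. The hypothesis is the Schmidt–Summerer conjecture for successive powers. *)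

theory Defs
  imports "HOL-Analysis.Analysis" "HOL-Computational_Algebra.Polynomial"
    "HOL-Computational_Algebra.Polynomial_Factorial"
begin

definition int_height :: "int poly \<Rightarrow> int" where
  "int_height P = Max (insert 0 (abs ` set (coeffs P)))"

definition rpoly :: "int poly \<Rightarrow> real \<Rightarrow> real" where
  "rpoly P x = poly (map_poly of_int P) x"

definition w_exp :: "nat \<Rightarrow> real \<Rightarrow> ereal" where
  "w_exp n \<zeta> = Sup (ereal ` {\<nu>::real. \<forall>X0::real. \<exists>X\<ge>X0. \<exists>P::int poly.
      P \<noteq> 0 \<and> degree P \<le> n \<and> real_of_int (int_height P) \<le> X \<and>
      \<bar>rpoly P \<zeta>\<bar> \<le> X powr (-\<nu>)})"

definition w_hat :: "nat \<Rightarrow> real \<Rightarrow> ereal" where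
  "w_hat n \<zeta> = Sup (ereal ` {\<nu>::real. \<exists>X0::real. \<forall>X\<ge>X0. \<exists>P::int poly.
      P \<noteq> 0 \<and> degree P \<le> n \<and> real_of_int (int_height P) \<le> X \<and>
      \<bar>rpoly P \<zeta>\<bar> \<le> X powr (-\<nu>)})"

text \<open>Irreducible minimal polynomial over Z of a real algebraic number
  (unique up to sign; we take positive leading coefficient).\<close>
definition min_int_poly :: "real \<Rightarrow> int poly" where
  "min_int_poly \<alpha> = (SOME P. irreducible P \<and> lead_coeff P > 0 \<and> rpoly P \<alpha> = 0)"

definition alg_height :: "real \<Rightarrow> int" where
  "alg_height \<alpha> = int_height (min_int_poly \<alpha>)"

definition alg_degree :: "real \<Rightarrow> nat" where
  "alg_degree \<alpha> = degree (min_int_poly \<alpha>)"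

definition w_hat_star :: "nat \<Rightarrow> real \<Rightarrow> ereal" where
  "w_hat_star n \<zeta> = Sup (ereal ` {\<nu>::real. \<exists>X0::real. \<forall>X\<ge>X0. \<exists>\<alpha>::real.
      algebraic \<alpha> \<and> alg_degree \<alpha> \<le> n \<and> real_of_int (alg_height \<alpha>) \<le> X \<and>
      0 < \<bar>\<zeta> - \<alpha>\<bar> \<and>
      \<bar>\<zeta> - \<alpha>\<bar> \<le> (1 / real_of_int (alg_height \<alpha>)) * X powr (-\<nu>)})"

text \<open>phi_n on [n,oo]; values below n are outside the domain (never used since w_n \<ge> n).\<close>
definition phi :: "nat \<Rightarrow> ereal \<Rightarrow> ereal" where
  "phi n w = (if w = \<infinity> then \<infinity>
     else if w \<le> ereal (real n) then ereal (real n)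
     else ereal (THE y. real n \<le> y \<and> y < real_of_ereal w \<and>
              real_of_ereal w - y + 1 = (real_of_ereal w / y) ^ n))"

definition tau :: real where
  "tau = (THE y. 0 < y \<and> y < 1 \<and> y * exp (1 / y) = 2 * sqrt (exp 1))"

definition Delta :: real where
  "Delta = ln (2 / tau) + 1"

end

theory Submission
  imports "Berlekamp_Zassenhaus.Factor_Bound" "Subresultants.Subresultant_Gcd"
    "HOL-Real_Asymp.Real_Asymp" Defs
begin

text \<open>
  If \<open>w_exp (n - 1) \<zeta> < w_exp n \<zeta>\<close>, then \<open>w = w_exp n \<zeta>\<close> is approximated by irreducible polynomials
  \<open>P\<close> of degree exactly \<open>n\<close>. Estimating the resultant of such a \<open>P\<close> and of a polynomial \<open>Q\<close> that
  witnesses the uniform exponent gives \<open>w_hat n \<zeta> \<le> n w / (w - n + 1)\<close>, which decreases in \<open>w\<close>,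
  while the hypothesis bounds \<open>w_hat n \<zeta>\<close> by \<open>phi n w\<close>, which increases. The two curves cross at height
  \<open>2 n - Delta + o(1)\<close>, and below \<open>2 n - 2\<close> as soon as \<open>n \<ge> 10\<close>.
  If \<open>w_exp m \<zeta> = w_exp n \<zeta>\<close> for some \<open>m < n\<close>, the same resultant estimate gives
  \<open>w_hat n \<zeta> \<le> m + n - 1\<close>, which settles \<open>m = n - 2\<close>, and \<open>m = n - 1\<close> for the bound \<open>2 n - 2\<close>. In the remaining case
  \<open>w_exp (n - 2) \<zeta> < w_exp (n - 1) \<zeta> = w_exp n \<zeta>\<close> the polynomials \<open>P\<close> have degree \<open>n - 1\<close>; a minimal
  polynomial \<open>Q\<close> is either associated to \<open>P\<close> or coprime to it, so the first argument still works
  for \<open>w_hat_star\<close>.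
\<close>

section \<open>Heights, Mahler measure and values of integer polynomials\<close>

abbreviation poly_height :: "int poly \<Rightarrow> real" where
  "poly_height P \<equiv> real_of_int (int_height P)"

lemma abs_coeff_le_int_height: "\<bar>coeff P i\<bar> \<le> int_height P"
proof (cases "i \<le> degree P \<and> P \<noteq> 0")
  case True
  then have "coeff P i \<in> set (coeffs P)"
    by (simp add: coeff_in_coeffs)
  then show ?thesis
    unfolding int_height_def by (intro Max_ge) auto
next
  case False
  then have "coeff P i = 0"
    by (auto simp: coeff_eq_0)
  moreover have "0 \<le> int_height P"
    unfolding int_height_def by (intro Max_ge) auto
  ultimately show ?thesis by simp
qed

lemma int_height_leI:
  assumes "0 \<le> b" "\<And>i. \<bar>coeff P i\<bar> \<le> b"
  shows "int_height P \<le> b"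
  unfolding int_height_def
  using assms by (auto simp: coeffs_def)

lemma int_height_ge_1:
  assumes "P \<noteq> 0"
  shows "1 \<le> int_height P"
proof -
  have "1 \<le> \<bar>lead_coeff P\<bar>"
    using assms leading_coeff_0_iff[of P] by linarith
  then show ?thesis
    using abs_coeff_le_int_height[of P "degree P"] by linarith
qed

lemma height_ge_1: "P \<noteq> 0 \<Longrightarrow> 1 \<le> poly_height P"
  using int_height_ge_1[of P] by linarith

lemma finite_bounded_height: "finite {P. degree P \<le> n \<and> poly_height P < B}"
proof (rule finite_subset)
  let ?L = "{xs. set xs \<subseteq> {- \<lceil>B\<rceil>..\<lceil>B\<rceil>} \<and> length xs \<le> Suc n}"
  show "finite (Poly ` ?L)"
    by (intro finite_imageI finite_lists_length_le) simp
  show "{P. degree P \<le> n \<and> poly_height P < B} \<subseteq> Poly ` ?L"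
  proof safe
    fix P :: "int poly"
    assume P: "degree P \<le> n" "poly_height P < B"
    have "x \<in> {- \<lceil>B\<rceil>..\<lceil>B\<rceil>}" if "x \<in> set (coeffs P)" for x
    proof -
      from that obtain i where "x = coeff P i"
        by (auto simp: coeffs_def split: if_splits)
      then have "\<bar>x\<bar> \<le> int_height P"
        using abs_coeff_le_int_height by simp
      then show ?thesis using P(2) by simp linarith
    qed
    moreover have "length (coeffs P) \<le> Suc n"
      using P(1) by (auto simp: coeffs_def)
    ultimately show "P \<in> Poly ` ?L"
      by (intro image_eqI[of _ _ "coeffs P"]) auto
  qed
qed

lemma mahler_measure_mult: "mahler_measure (P * Q) = mahler_measure P * mahler_measure Q"
  by (simp add: mahler_measure_def measure_eq_prod of_int_poly_hom.hom_mult)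

text \<open>Mignotte's inequality bounds the coefficient of index \<open>i\<close> by
  \<open>degree P choose i\<close> times the Mahler measure, and each of these binomials is at most
  \<open>2 ^ n\<close>.\<close>

lemma height_le_mahler_measure:
  assumes "degree P \<le> n"
  shows "poly_height P \<le> 2 ^ n * mahler_measure P"
proof -
  have "real_of_int \<bar>coeff P i\<bar> \<le> 2 ^ n * mahler_measure P" for i
  proof -
    have "real (degree P choose i) \<le> 2 ^ n"
    proof -
      have "degree P choose i \<le> 2 ^ degree P" by (rule binomial_le_pow2)
      also have "\<dots> \<le> 2 ^ n" using assms by (intro power_increasing) auto
      finally have "real (degree P choose i) \<le> real (2 ^ n)" by (rule of_nat_mono)
      then show ?thesis by simp
    qed
    then show ?thesis
      using Mignotte_bound[of P i] mult_right_mono[OF _ mahler_measure_ge_0[of P]] 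
      by (meson order_trans)
  qed
  then have "\<bar>coeff P i\<bar> \<le> \<lfloor>2 ^ n * mahler_measure P\<rfloor>" for i
    by (simp add: le_floor_iff)
  then have "int_height P \<le> \<lfloor>2 ^ n * mahler_measure P\<rfloor>"
    by (intro int_height_leI) (auto simp: mahler_measure_ge_0)
  then show ?thesis by (simp add: le_floor_iff)
qed

text \<open>Landau's inequality bounds the Mahler measure by the Euclidean norm of the coefficient
  vector, which has at most \<open>n + 1\<close> entries.\<close>

lemma mahler_measure_le_height:
  assumes "degree P \<le> n"
  shows "mahler_measure P \<le> real (Suc n) * poly_height P"
proof -
  let ?p = "map_poly complex_of_int P"
  have h0: "0 \<le> poly_height P"
    using abs_coeff_le_int_height[of P 0] by linarith
  have "mahler_measure P \<le> sqrt (\<Sum>a\<leftarrow>coeffs ?p. (cmod a)\<^sup>2)"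
    using Landau_inequality[of ?p] by (simp add: mahler_measure_def)
  also have "\<dots> \<le> sqrt ((real (Suc n) * poly_height P)\<^sup>2)"
  proof (rule real_sqrt_le_mono)
    have "(\<Sum>a\<leftarrow>coeffs ?p. (cmod a)\<^sup>2) \<le> (\<Sum>a\<leftarrow>coeffs ?p. (poly_height P)\<^sup>2)"
    proof (rule sum_list_mono)
      fix a assume "a \<in> set (coeffs ?p)"
      then obtain i where "a = coeff ?p i"
        by (auto simp: coeffs_def split: if_splits)
      then have "cmod a = real_of_int \<bar>coeff P i\<bar>"
        by (simp add: coeff_map_poly)
      also have "\<dots> \<le> poly_height P"
        using abs_coeff_le_int_height[of P i] by linarith
      finally show "(cmod a)\<^sup>2 \<le> (poly_height P)\<^sup>2"
        by (intro power_mono) auto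
    qed
    also have "\<dots> = real (length (coeffs ?p)) * (poly_height P)\<^sup>2"
      by (simp add: sum_list_triv)
    also have "\<dots> \<le> real (Suc n) * (poly_height P)\<^sup>2"
      using assms by (intro mult_right_mono) (auto simp: coeffs_def)
    \<comment> \<open>The factor \<open>n + 1\<close> is weakened to its square so that the square
      root can be taken exactly.\<close>
    also have "\<dots> \<le> (real (Suc n))\<^sup>2 * (poly_height P)\<^sup>2"
      by (intro mult_right_mono) (auto simp: power2_eq_square)
    finally show "(\<Sum>a\<leftarrow>coeffs ?p. (cmod a)\<^sup>2) \<le> (real (Suc n) * poly_height P)\<^sup>2"
      by (simp only: power_mult_distrib)
  qed
  also have "\<dots> = real (Suc n) * poly_height P"
    using h0 by simp
  finally show ?thesis .
qed

text \<open>The Mahler measure is multiplicative and at least 1 on the nonzero cofactor, so it does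
  not decrease from \<open>P\<close> to \<open>Q\<close>. The constants come from the two
  comparisons with the height.\<close>

lemma height_dvd_le:
  assumes "P dvd Q" "Q \<noteq> 0" "degree Q \<le> n"
  shows "poly_height P \<le> 2 ^ n * real (Suc n) * poly_height Q"
proof -
  from assms obtain R where R: "Q = P * R" by (auto elim: dvdE)
  have "degree P \<le> n"
    using assms dvd_imp_degree_le order_trans by blast
  then have "poly_height P \<le> 2 ^ n * mahler_measure P"
    by (rule height_le_mahler_measure)
  also have "\<dots> \<le> 2 ^ n * mahler_measure Q"
    using R assms(2) mahler_measure_poly_ge_1[of R] mahler_measure_ge_0[of P]
    by (auto simp: mahler_measure_mult intro: mult_left_le_one_le mult_le_cancel_left1[THEN iffD2])
  also have "\<dots> \<le> 2 ^ n * (real (Suc n) * poly_height Q)"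
    using mahler_measure_le_height[OF assms(3)] by (intro mult_left_mono) auto
  finally show ?thesis by (simp only: mult.assoc)
qed

section \<open>Values at a real point\<close>

lemma rpoly_mult: "rpoly (P * Q) x = rpoly P x * rpoly Q x"
  by (simp add: rpoly_def of_int_poly_hom.hom_mult)

lemma rpoly_eq_sum:
  assumes "degree P \<le> n"
  shows "rpoly P x = (\<Sum>i\<le>n. of_int (coeff P i) * x ^ i)"
proof -
  have "rpoly P x = (\<Sum>i\<le>degree P. of_int (coeff P i) * x ^ i)"
    by (simp add: rpoly_def poly_altdef coeff_map_poly)
  also have "\<dots> = (\<Sum>i\<le>n. of_int (coeff P i) * x ^ i)"
    using assms by (intro sum.mono_neutral_left) (auto simp: coeff_eq_0)
  finally show ?thesis .
qed

lemma rpoly_nonzero: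
  assumes "\<not> algebraic x" "P \<noteq> 0"
  shows "rpoly P x \<noteq> 0"
proof
  assume "rpoly P x = 0"
  then have "algebraic x"
    using assms(2) by (intro algebraicI[of "map_poly of_int P"]) (auto simp: rpoly_def coeff_map_poly)
  with assms(1) show False by simp
qed

lemma abs_rpoly_const_ge_1:
  assumes "degree P = 0" "P \<noteq> 0"
  shows "1 \<le> \<bar>rpoly P x\<bar>"
proof -
  have "rpoly P x = of_int (coeff P 0)"
    using assms rpoly_eq_sum[of P 0 x] by simp
  moreover have "coeff P 0 \<noteq> 0"
    using assms leading_coeff_0_iff[of P] by simp
  ultimately show ?thesis by linarith
qed

section \<open>Resultant estimates\<close>

text \<open>Row \<open>i\<close> of a Sylvester block lists the coefficients of \<open>p\<close>
  times the power \<open>N - 1 - m - i\<close> of the variable, in descending order; pairing it with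
  the powers of \<open>x\<close> evaluates that product.\<close>

lemma poly_shift_sum:
  fixes x :: real
  assumes "degree p \<le> m" "i + m < N"
  shows "(\<Sum>l<N. (if i \<le> l \<and> l \<le> m + i then of_int (coeff p (m + i - l)) else 0) * x ^ (N - 1 - l))
       = x ^ (N - 1 - m - i) * rpoly p x"
proof -
  have "(\<Sum>l<N. (if i \<le> l \<and> l \<le> m + i then of_int (coeff p (m + i - l)) else 0) * x ^ (N - 1 - l))
      = (\<Sum>l\<in>{i..m+i}. of_int (coeff p (m + i - l)) * x ^ (N - 1 - l))"
    using assms(2) by (intro sum.mono_neutral_cong_right) auto
  also have "\<dots> = (\<Sum>t\<le>m. x ^ (N - 1 - m - i) * (of_int (coeff p t) * x ^ t))"
  proof (rule sum.reindex_bij_witness[of _ "\<lambda>t. m + i - t" "\<lambda>l. m + i - l"])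
    fix l assume l: "l \<in> {i..m + i}"
    then have "N - 1 - l = (N - 1 - m - i) + (m + i - l)"
      using assms(2) by auto
    then show "x ^ (N - 1 - m - i) * (of_int (coeff p (m + i - l)) * x ^ (m + i - l))
        = of_int (coeff p (m + i - l)) * x ^ (N - 1 - l)"
      by (simp only: power_add) (simp add: mult_ac)
  qed auto
  also have "\<dots> = x ^ (N - 1 - m - i) * rpoly p x"
    by (simp add: rpoly_eq_sum[OF assms(1)] sum_distrib_left)
  finally show ?thesis .
qed

text \<open>Adding multiples of the other columns, the last column of the Sylvester matrix can be
  replaced by the values at \<open>x\<close> of the polynomials that the rows represent.\<close>

lemma resultant_height_bound:
  fixes P Q :: "int poly" and x :: real
  defines "m \<equiv> degree P" and "k \<equiv> degree Q"
  assumes res: "resultant P Q \<noteq> 0" and m: "0 < m" and k: "0 < k"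
  shows "1 \<le> fact (m + k) * max 1 \<bar>x\<bar> ^ (m + k) *
     (poly_height P ^ (k - 1) * poly_height Q ^ m * \<bar>rpoly P x\<bar> +
      poly_height P ^ k * poly_height Q ^ (m - 1) * \<bar>rpoly Q x\<bar>)"
proof -
  define N where "N = m + k"
  define A where "A = map_mat real_of_int (sylvester_mat P Q)"
  \<comment> \<open>The identity with its last column replaced by the powers of \<open>x\<close>. It
    is upper triangular with corner entry \<open>x ^ 0\<close>, so the column operation preserves
    the determinant.\<close>
  define U where "U = Matrix.mat N N (\<lambda>(i,j). if j = N - 1 then x ^ (N - 1 - i) else if i = j then 1 else 0)"
  define B where "B = A * U"
  define M where "M = max 1 \<bar>x\<bar>"
  define hp where "hp = poly_height P"
  define hq where "hq = poly_height Q"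
  have nz: "P \<noteq> 0" "Q \<noteq> 0" using m k by (auto simp: m_def k_def)
  have hp: "1 \<le> hp" and hq: "1 \<le> hq"
    using nz by (simp_all only: hp_def hq_def height_ge_1 not_False_eq_True)
  have N: "0 < N" using m by (simp add: N_def)
  have A: "A \<in> carrier_mat N N" and U: "U \<in> carrier_mat N N"
    using sylvester_carrier_mat[of P Q] by (auto simp: A_def U_def N_def m_def k_def)
  then have B: "B \<in> carrier_mat N N" by (simp add: B_def)
  have detA: "Determinant.det A = of_int (resultant P Q)"
    by (simp add: A_def resultant_def of_int_hom.hom_det)
  have "upper_triangular U"
    using U by (auto simp: upper_triangular_def U_def)
  then have "Determinant.det U = prod_list (diag_mat U)"
    using U by (rule det_upper_triangular)
  also have "diag_mat U = map (\<lambda>i. 1) [0..<N]"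
    using U by (auto simp: diag_mat_def U_def)
  also have "prod_list \<dots> = 1" by (induction N) auto
  finally have "Determinant.det B = of_int (resultant P Q)"
    using det_mult[OF A U] detA by (simp add: B_def)
  then have det1: "1 \<le> \<bar>Determinant.det B\<bar>"
    using res by (simp flip: of_int_abs)
  have Aij: "A $$ (i, j) = (if i < k then (if i \<le> j \<and> j \<le> m + i then of_int (coeff P (m + i - j)) else 0)
     else (if i - k \<le> j \<and> j \<le> k + (i - k) then of_int (coeff Q (k + (i - k) - j)) else 0))"
    if "i < N" "j < N" for i j
    using that
    by (auto simp: A_def sylvester_index_mat m_def k_def N_def)
  have absA: "\<bar>A $$ (i, j)\<bar> \<le> (if i < k then hp else hq)" if "i < N" "j < N" for i j
    using abs_coeff_le_int_height[of P] abs_coeff_le_int_height[of Q] hp hq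
    unfolding Aij[OF that] hp_def hq_def by (auto simp flip: of_int_abs)
  have Bsum: "B $$ (i, j) = (\<Sum>l<N. A $$ (i, l) * U $$ (l, j))" if "i < N" "j < N" for i j
    using that A U by (simp add: B_def scalar_prod_def atLeast0LessThan)
  have B_other: "B $$ (i, j) = A $$ (i, j)" if "i < N" "j < N" "j \<noteq> N - 1" for i j
  proof -
    have "B $$ (i, j) = (\<Sum>l<N. if l = j then A $$ (i, l) else 0)"
      unfolding Bsum[OF that(1,2)] using that by (intro sum.cong) (auto simp: U_def)
    then show ?thesis using that by simp
  qed
  have B_last: "\<bar>B $$ (i, N - 1)\<bar> \<le> M ^ N * (if i < k then \<bar>rpoly P x\<bar> else \<bar>rpoly Q x\<bar>)"
    if i: "i < N" for i
  proof -
    have pow: "\<bar>x ^ e\<bar> \<le> M ^ N" if "e \<le> N" for e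
    proof -
      have "\<bar>x\<bar> ^ e \<le> M ^ e" by (intro power_mono) (auto simp: M_def)
      also have "\<dots> \<le> M ^ N" using that by (intro power_increasing) (auto simp: M_def)
      finally show ?thesis by (simp add: power_abs)
    qed
    have "B $$ (i, N - 1) = (\<Sum>l<N. A $$ (i, l) * x ^ (N - 1 - l))"
      using Bsum[of i "N - 1"] i N by (auto simp: U_def intro!: sum.cong)
    also have "\<dots> = (if i < k then x ^ (N - 1 - m - i) * rpoly P x
                     else x ^ (N - 1 - k - (i - k)) * rpoly Q x)"
    proof (cases "i < k")
      case True
      then show ?thesis
        using poly_shift_sum[of P m i N x] i by (simp add: Aij m_def N_def)
    next
      case False
      then show ?thesis
        using poly_shift_sum[of Q k "i - k" N x] i by (simp add: Aij k_def N_def)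
    qed
    finally show ?thesis
      using pow[of "N - 1 - m - i"] pow[of "N - 1 - k - (i - k)"]
      by (auto simp: abs_mult intro!: mult_right_mono)
  qed
  define T where "T = M ^ N * (hp ^ (k - 1) * hq ^ m * \<bar>rpoly P x\<bar> + hp ^ k * hq ^ (m - 1) * \<bar>rpoly Q x\<bar>)"
  \<comment> \<open>Each Leibniz term contains one entry of the last column, in row
    \<open>i0\<close>. It supplies the small factor; every other row contributes one height, so one
    power of the height belonging to row \<open>i0\<close> is missing.\<close>
  have leibniz: "\<bar>signof \<pi> * (\<Prod>i = 0..<N. B $$ (i, \<pi> i))\<bar> \<le> T" if \<pi>: "\<pi> permutes {0..<N}" for \<pi>
  proof -
    define f where "f i = (if i < k then hp else hq)" for i
    have f1: "1 \<le> f i" for i using hp hq by (simp add: f_def)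
    have "N - 1 \<in> \<pi> ` {0..<N}" using N by (simp add: permutes_image[OF \<pi>])
    then obtain i0 where i0: "i0 < N" "\<pi> i0 = N - 1" by auto
    have lt: "\<pi> i < N" if "i < N" for i
      using permutes_in_image[OF \<pi>, of i] that by simp
    have ne: "\<pi> i \<noteq> N - 1" if "i \<noteq> i0" for i
      using permutes_inj[OF \<pi>] i0 that by (metis injD)
    have prodf: "(\<Prod>i\<in>{0..<N}. f i) = hp ^ k * hq ^ m"
    proof -
      have "{0..<N} = {0..<k} \<union> {k..<N}" "{0..<k} \<inter> {k..<N} = {}"
        by (auto simp: N_def)
      then have "(\<Prod>i\<in>{0..<N}. f i) = (\<Prod>i\<in>{0..<k}. f i) * (\<Prod>i\<in>{k..<N}. f i)"
        by (simp add: prod.union_disjoint)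
      also have "(\<Prod>i\<in>{0..<k}. f i) = hp ^ k" by (simp add: f_def)
      also have "(\<Prod>i\<in>{k..<N}. f i) = hq ^ m" by (simp add: f_def N_def)
      finally show ?thesis .
    qed
    have rest: "(\<Prod>i\<in>{0..<N} - {i0}. f i) = (if i0 < k then hp ^ (k - 1) * hq ^ m else hp ^ k * hq ^ (m - 1))"
    proof -
      have "f i0 * (\<Prod>i\<in>{0..<N} - {i0}. f i) = hp ^ k * hq ^ m"
        using i0 prodf by (subst prod.remove[symmetric]) auto
      moreover have "hp ^ k = hp * hp ^ (k - 1)" "hq ^ m = hq * hq ^ (m - 1)"
        using power_minus_mult[OF k, of hp] power_minus_mult[OF m, of hq] by (auto simp: mult.commute)
      ultimately have "f i0 * (\<Prod>i\<in>{0..<N} - {i0}. f i)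
          = f i0 * (if i0 < k then hp ^ (k - 1) * hq ^ m else hp ^ k * hq ^ (m - 1))"
        by (simp add: f_def)
      then show ?thesis
        using f1[of i0] by simp
    qed
    have "\<bar>signof \<pi> * (\<Prod>i = 0..<N. B $$ (i, \<pi> i))\<bar> = (\<Prod>i = 0..<N. \<bar>B $$ (i, \<pi> i)\<bar>)"
      by (simp add: abs_mult abs_prod sign_def)
    also have "\<dots> = \<bar>B $$ (i0, N - 1)\<bar> * (\<Prod>i\<in>{0..<N} - {i0}. \<bar>B $$ (i, \<pi> i)\<bar>)"
      using i0 by (subst prod.remove[of _ i0]) auto
    also have "\<dots> \<le> \<bar>B $$ (i0, N - 1)\<bar> * (\<Prod>i\<in>{0..<N} - {i0}. f i)"
      using lt ne absA by (intro mult_left_mono prod_mono) (auto simp: B_other f_def)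
    also have "\<dots> \<le> (M ^ N * (if i0 < k then \<bar>rpoly P x\<bar> else \<bar>rpoly Q x\<bar>)) * (\<Prod>i\<in>{0..<N} - {i0}. f i)"
      using f1 by (intro mult_right_mono B_last i0 prod_nonneg) (meson le_numeral_extra(1) order_trans)
    also have "\<dots> \<le> T"
    proof -
      have "0 \<le> M ^ N" by (simp add: M_def)
      then show ?thesis
        unfolding rest T_def using hp hq
        by (auto simp: mult_ac intro!: mult_left_mono mult_nonneg_nonneg)
    qed
    finally show ?thesis .
  qed
  have "\<bar>Determinant.det B\<bar> \<le> (\<Sum>\<pi>\<in>{\<pi>. \<pi> permutes {0..<N}}. T)"
    unfolding det_def'[OF B] using leibniz by (intro order_trans[OF sum_abs] sum_mono) auto
  also have "\<dots> = fact N * T"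
    by (simp add: card_permutations[OF refl])
  finally show ?thesis
    using det1 by (simp add: T_def N_def M_def hp_def hq_def mult.assoc)
qed

text \<open>Replaces the exact degree and height of \<open>Q\<close> by upper bounds, which makes
  the estimate uniform in \<open>Q\<close>.\<close>

lemma coprime_height_bound:
  fixes P Q :: "int poly" and x :: real
  assumes "irreducible P" "\<not> P dvd Q" "degree P = p" "0 < p" "degree Q \<le> n" "0 < n"
    and X: "poly_height Q \<le> X"
  shows "1 \<le> fact (p + n) * max 1 \<bar>x\<bar> ^ (p + n) *
     (poly_height P ^ (n - 1) * X ^ p * \<bar>rpoly P x\<bar> + poly_height P ^ n * X ^ (p - 1) * \<bar>rpoly Q x\<bar>)"
proof -
  let ?M = "max 1 \<bar>x\<bar>"
  have nz: "P \<noteq> 0" "Q \<noteq> 0" using assms by auto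
  have hP: "1 \<le> poly_height P" and hQ: "1 \<le> poly_height Q"
    using nz by (simp_all only: height_ge_1 not_False_eq_True)
  have X1: "1 \<le> X" using X hQ by simp
  have C1: "1 \<le> (fact (p + n) * ?M ^ (p + n) :: real)"
    using mult_mono[OF fact_ge_1[of "p + n", where ?'a = real] one_le_power[of ?M "p + n"]] by simp
  show ?thesis
  proof (cases "degree Q = 0")
    \<comment> \<open>A constant \<open>Q\<close> is outside the range of the resultant estimate,
      but its value has modulus at least 1, so the second summand alone suffices.\<close>
    case True
    then have "1 * (1 * 1) * 1 \<le> (fact (p + n) * ?M ^ (p + n)) * (poly_height P ^ n * X ^ (p - 1)) * \<bar>rpoly Q x\<bar>"
      using nz hP X1 C1 abs_rpoly_const_ge_1[of Q x]
      by (intro mult_mono) auto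
    also have "\<dots> \<le> fact (p + n) * ?M ^ (p + n) *
     (poly_height P ^ (n - 1) * X ^ p * \<bar>rpoly P x\<bar> + poly_height P ^ n * X ^ (p - 1) * \<bar>rpoly Q x\<bar>)"
      using C1 hP X1 by (subst mult.assoc) (intro mult_left_mono, auto)
    finally show ?thesis by simp
  next
    case False
    define k where "k = degree Q"
    have k: "0 < k" "k \<le> n" using False assms by (auto simp: k_def)
    \<comment> \<open>An irreducible polynomial not dividing \<open>Q\<close> is coprime to it, so
      the resultant does not vanish.\<close>
    have "prime_elem P" using assms(1) by (simp add: irreducible_imp_prime_elem)
    then have "gcd P Q = 1"
      using prime_elem_imp_coprime[OF _ assms(2)] by (intro coprime_imp_gcd_eq_1)
    then have "degree (gcd P Q) = 0" by simp
    then have "resultant P Q \<noteq> 0" by (simp add: resultant_0_gcd)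
    then have "1 \<le> fact (p + k) * ?M ^ (p + k) *
     (poly_height P ^ (k - 1) * poly_height Q ^ p * \<bar>rpoly P x\<bar> + poly_height P ^ k * poly_height Q ^ (p - 1) * \<bar>rpoly Q x\<bar>)"
      using resultant_height_bound[of P Q x] assms k by (simp add: k_def)
    also have "\<dots> \<le> fact (p + n) * ?M ^ (p + n) *
     (poly_height P ^ (n - 1) * X ^ p * \<bar>rpoly P x\<bar> + poly_height P ^ n * X ^ (p - 1) * \<bar>rpoly Q x\<bar>)"
    proof -
      have f: "(fact (p + k) :: real) \<le> fact (p + n)" using k by (intro fact_mono) auto
      have M: "?M ^ (p + k) \<le> ?M ^ (p + n)" using k by (intro power_increasing) auto
      have h1: "poly_height P ^ (k - 1) \<le> poly_height P ^ (n - 1)"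
        using k hP by (intro power_increasing) auto
      have h2: "poly_height P ^ k \<le> poly_height P ^ n"
        using k hP by (intro power_increasing) auto
      have q: "poly_height Q ^ j \<le> X ^ j" for j
        using X hQ by (intro power_mono) auto
      have nonneg: "0 \<le> poly_height P ^ j" "0 \<le> poly_height Q ^ j" "0 \<le> X ^ j" for j
        using hP hQ X1 by auto
      show ?thesis
        by (rule mult_mono[OF mult_mono[OF f M] add_mono[OF
              mult_right_mono[OF mult_mono[OF h1 q]] mult_right_mono[OF mult_mono[OF h2 q]]]])
           (auto intro!: mult_nonneg_nonneg add_nonneg_nonneg nonneg)
    qed
    finally show ?thesis .
  qed
qed

section \<open>The exponents of polynomial approximation\<close>

text \<open>Serves to absorb constants into a gap \<open>e\<close> between two exponents.\<close>

lemma powr_dominates: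
  fixes e K :: real
  assumes "0 < e"
  obtains X0 where "1 \<le> X0" "\<And>X. X0 \<le> X \<Longrightarrow> K < X powr e"
proof
  let ?X0 = "max 1 ((\<bar>K\<bar> + 1) powr (1 / e))"
  show "1 \<le> ?X0" by simp
  fix X assume X: "?X0 \<le> X"
  have "K < \<bar>K\<bar> + 1" by linarith
  also have "\<dots> = ((\<bar>K\<bar> + 1) powr (1 / e)) powr e"
    using assms by (simp add: powr_powr)
  also have "\<dots> \<le> X powr e"
    using X assms by (intro powr_mono2) auto
  finally show "K < X powr e" .
qed

lemma w_exp_greaterD:
  assumes "ereal w < w_exp n \<zeta>"
  shows "\<exists>\<nu>>w. \<forall>X0. \<exists>X\<ge>X0. \<exists>P. P \<noteq> 0 \<and> degree P \<le> n \<and> poly_height P \<le> X \<and>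
    \<bar>rpoly P \<zeta>\<bar> \<le> X powr (-\<nu>)"
  using assms unfolding w_exp_def less_Sup_iff by auto

lemma w_hat_greaterD:
  assumes "ereal w < w_hat n \<zeta>"
  shows "\<exists>\<nu>>w. \<exists>X0. \<forall>X\<ge>X0. \<exists>P. P \<noteq> 0 \<and> degree P \<le> n \<and> poly_height P \<le> X \<and>
    \<bar>rpoly P \<zeta>\<bar> \<le> X powr (-\<nu>)"
  using assms unfolding w_hat_def less_Sup_iff by auto

lemma w_exp_geI:
  assumes "\<And>X0. \<exists>X\<ge>X0. \<exists>P. P \<noteq> 0 \<and> degree P \<le> n \<and> poly_height P \<le> X \<and> \<bar>rpoly P \<zeta>\<bar> \<le> X powr (-\<nu>)"
  shows "ereal \<nu> \<le> w_exp n \<zeta>"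
  unfolding w_exp_def using assms by (intro Sup_upper) auto

lemma w_hat_geI:
  assumes "\<And>X. X0 \<le> X \<Longrightarrow> \<exists>P. P \<noteq> 0 \<and> degree P \<le> n \<and> poly_height P \<le> X \<and> \<bar>rpoly P \<zeta>\<bar> \<le> X powr (-\<nu>)"
  shows "ereal \<nu> \<le> w_hat n \<zeta>"
  unfolding w_hat_def using assms by (intro Sup_upper) auto

lemma w_exp_mono:
  assumes "m \<le> n"
  shows "w_exp m \<zeta> \<le> w_exp n \<zeta>"
  unfolding w_exp_def
  by (intro Sup_subset_mono image_mono Collect_mono) (meson assms order_trans)

lemma w_hat_le_w_exp: "w_hat n \<zeta> \<le> w_exp n \<zeta>"
  unfolding w_hat_def w_exp_def
proof (intro Sup_subset_mono image_mono Collect_mono impI allI)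
  fix \<nu> X1 :: real
  assume "\<exists>X0. \<forall>X\<ge>X0. \<exists>P. P \<noteq> 0 \<and> degree P \<le> n \<and> poly_height P \<le> X \<and> \<bar>rpoly P \<zeta>\<bar> \<le> X powr - \<nu>"
  then obtain X0 where
    "\<exists>P. P \<noteq> 0 \<and> degree P \<le> n \<and> poly_height P \<le> max X0 X1 \<and> \<bar>rpoly P \<zeta>\<bar> \<le> max X0 X1 powr - \<nu>"
    by (meson max.cobounded1)
  then show "\<exists>X\<ge>X1. \<exists>P. P \<noteq> 0 \<and> degree P \<le> n \<and> poly_height P \<le> X \<and> \<bar>rpoly P \<zeta>\<bar> \<le> X powr - \<nu>"
    by (meson max.cobounded2)
qed

section \<open>Irreducible approximations\<close>

lemma mahler_measure_powr_le_1:
  assumes "P \<noteq> 0" "0 \<le> w"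
  shows "mahler_measure P powr (-w) \<le> 1"
  using mahler_measure_poly_ge_1[OF assms(1)] assms(2)
  by (simp add: powr_minus_divide ge_one_powr_ge_zero)

text \<open>The Mahler measure is multiplicative, so a lower bound \<open>M(P) powr (-w)\<close> for the values of
  irreducible polynomials passes to all polynomials.\<close>

lemma abs_rpoly_ge_of_irreducible:
  assumes w: "0 < w" and d: "0 < d" "d \<le> 1"
    and irr: "\<And>P. irreducible P \<Longrightarrow> degree P \<le> n \<Longrightarrow> d * mahler_measure P powr (-w) \<le> \<bar>rpoly P \<zeta>\<bar>"
  shows "P \<noteq> 0 \<Longrightarrow> degree P \<le> n \<Longrightarrow> d ^ degree P * mahler_measure P powr (-w) \<le> \<bar>rpoly P \<zeta>\<bar>"
proof (induction P rule: prime_divisors_induct)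
  case zero
  then show ?case by simp
next
  case (unit x)
  then have "degree x = 0" by (simp add: poly_dvd_1)
  have "mahler_measure x powr (-w) \<le> 1"
    using unit w by (intro mahler_measure_powr_le_1) auto
  then show ?case using abs_rpoly_const_ge_1[of x \<zeta>] unit \<open>degree x = 0\<close> by simp
next
  case (factor p x)
  have p: "prime_elem p" "p \<noteq> 0" "x \<noteq> 0" using factor by auto
  then have "irreducible p" by (simp add: prime_elem_imp_irreducible)
  have deg: "degree (p * x) = degree p + degree x" using p by (simp add: degree_mult_eq)
  then have degs: "degree p \<le> n" "degree x \<le> n" using factor by auto
  \<comment> \<open>The exponent \<open>degree p\<close> charges \<open>d\<close> to nonconstant
    factors only, so the total loss is controlled by the degree; a nonzero constant has modulus at
    least 1 anyway.\<close>
  have "d ^ degree p * mahler_measure p powr (-w) \<le> \<bar>rpoly p \<zeta>\<bar>"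
  proof (cases "degree p = 0")
    case True
    have "mahler_measure p powr (-w) \<le> 1"
      using p w by (intro mahler_measure_powr_le_1) auto
    then show ?thesis using abs_rpoly_const_ge_1[OF True p(2), of \<zeta>] True by simp
  next
    case False
    then have "d ^ degree p \<le> d" using d power_decreasing[of 1 "degree p" d] by simp
    then have "d ^ degree p * mahler_measure p powr (-w) \<le> d * mahler_measure p powr (-w)"
      by (intro mult_right_mono) auto
    also have "\<dots> \<le> \<bar>rpoly p \<zeta>\<bar>" using irr \<open>irreducible p\<close> degs by simp
    finally show ?thesis .
  qed
  moreover have "d ^ degree x * mahler_measure x powr (-w) \<le> \<bar>rpoly x \<zeta>\<bar>"
    using factor.IH p degs by simp
  ultimately have "(d ^ degree p * mahler_measure p powr (-w)) * (d ^ degree x * mahler_measure x powr (-w))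
      \<le> \<bar>rpoly p \<zeta>\<bar> * \<bar>rpoly x \<zeta>\<bar>"
    using d by (intro mult_mono) auto
  then show ?case
    by (simp add: deg rpoly_mult abs_mult mahler_measure_mult power_add powr_mult
        mahler_measure_ge_0 mult_ac)
qed

text \<open>Otherwise irreducible polynomials of large height satisfy a lower bound with exponent
  \<open>w\<close>, and the finitely many others do so up to a constant because
  \<open>\<zeta>\<close> is transcendental. Multiplicativity extends the bound to all polynomials,
  against \<open>w < w_exp n \<zeta>\<close>.\<close>

lemma ex_irreducible_approx:
  assumes tr: "\<not> algebraic \<zeta>" and w: "0 < w" "ereal w < w_exp n \<zeta>"
  shows "\<exists>P. irreducible P \<and> degree P \<le> n \<and> B \<le> poly_height P \<and> \<bar>rpoly P \<zeta>\<bar> \<le> poly_height P powr (-w)"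
proof (rule ccontr)
  assume "\<not> ?thesis"
  then have no: "poly_height P powr (-w) < \<bar>rpoly P \<zeta>\<bar>"
    if "irreducible P" "degree P \<le> n" "B \<le> poly_height P" for P
    using that not_le by blast
  define S where "S = {P. degree P \<le> n \<and> poly_height P < B} - {0}"
  have finS: "finite S" unfolding S_def using finite_bounded_height by simp
  define c where "c = Min (insert 1 ((\<lambda>P. \<bar>rpoly P \<zeta>\<bar>) ` S))"
  have c: "0 < c" "c \<le> 1" "\<And>P. P \<in> S \<Longrightarrow> c \<le> \<bar>rpoly P \<zeta>\<bar>"
    using finS rpoly_nonzero[OF tr] by (auto simp: c_def S_def)
  \<comment> \<open>\<open>c\<close> handles the small heights, and the second factor pays for
    comparing the height with the Mahler measure at large heights.\<close>
  define d where "d = c * (2 ^ n) powr (-w)"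
  have "(2 ^ n) powr (-w) \<le> (1::real)"
    using w by (simp add: powr_minus_divide ge_one_powr_ge_zero)
  then have d: "0 < d" "d \<le> 1" "d \<le> c" "d \<le> (2 ^ n) powr (-w)"
    using c by (auto simp: d_def intro!: mult_le_one mult_left_le mult_left_le_one_le)
  have irr: "d * mahler_measure P powr (-w) \<le> \<bar>rpoly P \<zeta>\<bar>"
    if P: "irreducible P" "degree P \<le> n" for P
  proof -
    have P0: "P \<noteq> 0" using P by auto
    have M1: "1 \<le> mahler_measure P" using mahler_measure_poly_ge_1[OF P0] .
    have M1': "mahler_measure P powr (-w) \<le> 1"
      using P0 w by (intro mahler_measure_powr_le_1) auto
    show ?thesis
    proof (cases "P \<in> S")
      case True
      have "d * mahler_measure P powr (-w) \<le> c * 1"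
        using d c M1' by (intro mult_mono) auto
      then show ?thesis using c(3)[OF True] by simp
    next
      case False
      then have "B \<le> poly_height P" using P P0 by (auto simp: S_def)
      have "d * mahler_measure P powr (-w) \<le> (2 ^ n) powr (-w) * mahler_measure P powr (-w)"
        using d by (intro mult_right_mono) auto
      also have "\<dots> = (2 ^ n * mahler_measure P) powr (-w)"
        using M1 by (simp add: powr_mult)
      also have "\<dots> \<le> poly_height P powr (-w)"
        using w height_le_mahler_measure[OF P(2)] height_ge_1[OF P0]
        by (intro powr_mono2') auto
      also have "\<dots> \<le> \<bar>rpoly P \<zeta>\<bar>"
        using no[OF P \<open>B \<le> poly_height P\<close>] by simp
      finally show ?thesis .
    qed
  qed
  obtain \<nu> where \<nu>: "w < \<nu>"
    "\<forall>X0. \<exists>X\<ge>X0. \<exists>P. P \<noteq> 0 \<and> degree P \<le> n \<and> poly_height P \<le> X \<and> \<bar>rpoly P \<zeta>\<bar> \<le> X powr (-\<nu>)"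
    using w_exp_greaterD[OF w(2)] by blast
  \<comment> \<open>The constant in the lower bound \<open>K * X powr (-w)\<close>: at most
    \<open>n\<close> factors \<open>d\<close>, and the loss from bounding the Mahler measure by
    \<open>(n + 1) * X\<close>.\<close>
  define K where "K = d ^ n * real (Suc n) powr (-w)"
  have K: "0 < K" using d by (simp add: K_def)
  obtain X0 where X0: "1 \<le> X0" "\<And>X. X0 \<le> X \<Longrightarrow> 1 / K < X powr (\<nu> - w)"
    using powr_dominates[of "\<nu> - w" "1 / K"] \<nu>(1) by auto
  obtain X P where XP: "X0 \<le> X" "P \<noteq> 0" "degree P \<le> n" "poly_height P \<le> X" "\<bar>rpoly P \<zeta>\<bar> \<le> X powr (-\<nu>)"
    using \<nu>(2) by blast
  have X1: "1 \<le> X" using XP X0 by simp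
  have M1: "1 \<le> mahler_measure P" using mahler_measure_poly_ge_1[OF XP(2)] .
  have "mahler_measure P \<le> real (Suc n) * X"
    using mahler_measure_le_height[OF XP(3)] XP(4) by (meson mult_left_mono of_nat_0_le_iff order_trans)
  then have "(real (Suc n) * X) powr (-w) \<le> mahler_measure P powr (-w)"
    using w M1 by (intro powr_mono2') auto
  moreover have "(real (Suc n) * X) powr (-w) = real (Suc n) powr (-w) * X powr (-w)"
    by (rule powr_mult)
  moreover have "d ^ n \<le> d ^ degree P" using d XP(3) by (intro power_decreasing) auto
  ultimately have "d ^ n * (real (Suc n) powr (-w) * X powr (-w)) \<le> d ^ degree P * mahler_measure P powr (-w)"
    using d by (intro mult_mono) auto
  then have "K * X powr (-w) \<le> d ^ degree P * mahler_measure P powr (-w)"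
    by (simp add: K_def mult.assoc)
  also have "\<dots> \<le> \<bar>rpoly P \<zeta>\<bar>"
    by (rule abs_rpoly_ge_of_irreducible[OF w(1) d(1,2) irr XP(2,3)])
  also have "\<dots> \<le> X powr (-\<nu>)" by fact
  also have "\<dots> = X powr (-w) / X powr (\<nu> - w)"
    using X1 by (simp flip: powr_diff)
  finally have "X powr (\<nu> - w) \<le> 1 / K"
    using K X1 by (simp add: field_simps)
  then show False using X0(2)[OF XP(1)] by simp
qed

text \<open>Since \<open>w\<close> exceeds \<open>w_exp m \<zeta>\<close>, polynomials of degree at
  most \<open>m\<close> and large height cannot reach this quality, so the degree is forced.\<close>

lemma ex_irreducible_approx_degree:
  assumes tr: "\<not> algebraic \<zeta>" and w: "0 < w" "w_exp m \<zeta> < ereal w" "ereal w < w_exp (Suc m) \<zeta>"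
  shows "\<exists>P. irreducible P \<and> degree P = Suc m \<and> B \<le> poly_height P \<and> \<bar>rpoly P \<zeta>\<bar> \<le> poly_height P powr (-w)"
proof -
  have "\<not> ereal w \<le> w_exp m \<zeta>" using w by simp
  then obtain X0 where X0: "\<And>X P. \<lbrakk>X0 \<le> X; P \<noteq> 0; degree P \<le> m; poly_height P \<le> X\<rbrakk> \<Longrightarrow> \<not> \<bar>rpoly P \<zeta>\<bar> \<le> X powr (-w)"
    using w_exp_geI[of m \<zeta> w] by meson
  obtain P where P: "irreducible P" "degree P \<le> Suc m" "max B X0 \<le> poly_height P"
      "\<bar>rpoly P \<zeta>\<bar> \<le> poly_height P powr (-w)"
    using ex_irreducible_approx[OF tr w(1,3)] by blast
  then have "\<not> degree P \<le> m" using X0[of "poly_height P" P] by auto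
  then show ?thesis using P by (intro exI[of _ P]) auto
qed

text \<open>If the bound failed, both exponents would exceed \<open>y = m + n - 1\<close>. In the
  resultant of an irreducible \<open>P\<close> of degree at most \<open>m\<close> and a uniform
  approximation \<open>Q\<close> of slightly smaller height, the heights contribute a total power of
  at most \<open>y\<close>, so both summands become small.\<close>

lemma w_hat_le_of_w_hat_le_w_exp:
  assumes tr: "\<not> algebraic \<zeta>" and mn: "1 \<le> m" "1 \<le> n"
    and le: "w_hat n \<zeta> \<le> w_exp m \<zeta>"
  shows "w_hat n \<zeta> \<le> ereal (real m + real n - 1)"
proof (rule ccontr)
  define y where "y = real m + real n - 1"
  assume "\<not> ?thesis"
  then have gt: "ereal y < w_hat n \<zeta>" by (simp add: y_def)
  obtain \<nu> X0 where \<nu>: "y < \<nu>" and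
    Q: "\<forall>X\<ge>X0. \<exists>P. P \<noteq> 0 \<and> degree P \<le> n \<and> poly_height P \<le> X \<and> \<bar>rpoly P \<zeta>\<bar> \<le> X powr (-\<nu>)"
    using w_hat_greaterD[OF gt] by blast
  obtain w where w: "y < w" "ereal w < w_exp m \<zeta>"
    using ereal_dense2[of "ereal y" "w_exp m \<zeta>"] gt le by force
  have y1: "1 \<le> y" using mn by (simp add: y_def)
  have w0: "0 < w" using w y1 by simp
  have powr_y: "z powr y = z ^ i * z ^ j" if "0 < z" "i + j + 1 = m + n" for z :: real and i j
  proof -
    have "y = real (i + j)" using that(2) unfolding y_def by linarith
    then show ?thesis using that(1) by (simp only: powr_realpow power_add)
  qed
  define C where "C = (fact (m + n) * max 1 \<bar>\<zeta>\<bar> ^ (m + n) :: real)"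
  \<comment> \<open>Twice the constant of \<open>height_dvd_le\<close>: a nonzero multiple of
    \<open>P\<close> of degree at most \<open>n\<close> has height at least \<open>2 * X\<close>
    when \<open>X = h / D\<close>, so \<open>P\<close> cannot divide \<open>Q\<close>.\<close>
  define D where "D = 2 * (2 ^ n * real (Suc n))"
  have C: "0 < C" by (simp add: C_def)
  have D: "1 \<le> D"
  proof -
    have "1 * 1 \<le> (2 ^ n * real (Suc n) :: real)" by (intro mult_mono) auto
    then show ?thesis by (simp add: D_def)
  qed
  obtain X1 where X1: "1 \<le> X1" "\<And>X. X1 \<le> X \<Longrightarrow> 2 * C < X powr (w - y)"
    using powr_dominates[of "w - y" "2 * C"] w by auto
  obtain X2 where X2: "1 \<le> X2" "\<And>X. X2 \<le> X \<Longrightarrow> 2 * C * D ^ n < X powr (\<nu> - y)"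
    using powr_dominates[of "\<nu> - y" "2 * C * D ^ n"] \<nu> by auto
  obtain P where P: "irreducible P" "degree P \<le> m" "D * max (max X0 X1) (max X2 2) \<le> poly_height P"
      "\<bar>rpoly P \<zeta>\<bar> \<le> poly_height P powr (-w)"
    using ex_irreducible_approx[OF tr w0 w(2)] by blast
  define h where "h = poly_height P"
  define X where "X = h / D"
  have hX: "h = D * X" using D by (simp add: X_def)
  have "D * max (max X0 X1) (max X2 2) \<le> D * X"
    using P(3) by (simp only: h_def[symmetric] hX[symmetric])
  then have "max (max X0 X1) (max X2 2) \<le> X"
    by (rule mult_left_le_imp_le) (use D in linarith)
  then have Xge: "X0 \<le> X" "X1 \<le> X" "X2 \<le> X" "2 \<le> X" by auto
  have Xh: "X \<le> h" using mult_right_mono[OF D, of X] Xge by (simp add: hX)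
  obtain Q where Q: "Q \<noteq> 0" "degree Q \<le> n" "poly_height Q \<le> X" "\<bar>rpoly Q \<zeta>\<bar> \<le> X powr (-\<nu>)"
    using Q Xge(1) by blast
  have P0: "P \<noteq> 0" using P by auto
  have degP: "0 < degree P"
  proof (rule ccontr)
    assume "\<not> 0 < degree P"
    then have "1 \<le> \<bar>rpoly P \<zeta>\<bar>" using abs_rpoly_const_ge_1[of P \<zeta>] P0 by simp
    moreover have "h powr (-w) < h powr 0"
      using Xh Xge w y1 by (intro powr_less_mono) auto
    ultimately show False using P(4) Xh Xge by (simp add: h_def)
  qed
  have ndvd: "\<not> P dvd Q"
  proof
    assume "P dvd Q"
    then have "h \<le> 2 ^ n * real (Suc n) * poly_height Q"
      unfolding h_def using Q by (intro height_dvd_le) auto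
    also have "\<dots> \<le> (D / 2) * X" using Q(3) by (simp add: D_def mult_left_mono)
    finally show False using hX D Xge by simp
  qed
  define p where "p = degree P"
  have p: "0 < p" "p \<le> m" using degP P by (auto simp: p_def)
  have "1 \<le> fact (p + n) * max 1 \<bar>\<zeta>\<bar> ^ (p + n) *
     (h ^ (n - 1) * X ^ p * \<bar>rpoly P \<zeta>\<bar> + h ^ n * X ^ (p - 1) * \<bar>rpoly Q \<zeta>\<bar>)"
    unfolding h_def using coprime_height_bound[OF P(1) ndvd _ p(1) Q(2) _ Q(3), of \<zeta>] mn by (simp add: p_def)
  also have "\<dots> \<le> C * (h ^ (n - 1) * h ^ m * h powr (-w) + (D * X) ^ n * X ^ (m - 1) * X powr (-\<nu>))"
  proof -
    have f: "(fact (p + n) :: real) \<le> fact (m + n)" using p by (intro fact_mono) auto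
    have M: "max 1 \<bar>\<zeta>\<bar> ^ (p + n) \<le> max 1 \<bar>\<zeta>\<bar> ^ (m + n)" using p by (intro power_increasing) auto
    have "X ^ p \<le> h ^ p" using Xh Xge by (intro power_mono) auto
    also have "\<dots> \<le> h ^ m" using Xh Xge p by (intro power_increasing) auto
    finally have 1: "h ^ (n - 1) * X ^ p * \<bar>rpoly P \<zeta>\<bar> \<le> h ^ (n - 1) * h ^ m * h powr (-w)"
      using P(4) Xh Xge unfolding h_def[symmetric] by (intro mult_mono) auto
    have "X ^ (p - 1) \<le> X ^ (m - 1)" using Xge p by (intro power_increasing) auto
    then have 2: "h ^ n * X ^ (p - 1) * \<bar>rpoly Q \<zeta>\<bar> \<le> (D * X) ^ n * X ^ (m - 1) * X powr (-\<nu>)"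
      using Q(4) Xh Xge unfolding hX[symmetric] by (intro mult_mono) auto
    show ?thesis
      unfolding C_def using Xh Xge
      by (intro mult_mono[OF mult_mono[OF f M] add_mono[OF 1 2]]) auto
  qed
  also have "h ^ (n - 1) * h ^ m * h powr (-w) = h powr (- (w - y))"
  proof -
    have "h ^ (n - 1) * h ^ m = h powr y"
      using Xh Xge mn by (intro powr_y[symmetric]) auto
    then show ?thesis by (simp flip: powr_add)
  qed
  also have "(D * X) ^ n * X ^ (m - 1) * X powr (-\<nu>) = D ^ n * X powr (- (\<nu> - y))"
  proof -
    have "X ^ n * X ^ (m - 1) = X powr y"
      using Xge mn by (intro powr_y[symmetric]) auto
    then have "X ^ n * X ^ (m - 1) * X powr (-\<nu>) = X powr (- (\<nu> - y))" by (simp flip: powr_add)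
    then show ?thesis by (simp add: power_mult_distrib mult.assoc)
  qed
  also have "C * (h powr (- (w - y)) + D ^ n * X powr (- (\<nu> - y))) < 1"
  proof -
    \<comment> \<open>The choices of \<open>X1\<close> and \<open>X2\<close> make each summand
      smaller than one half.\<close>
    have half: "K * z powr (-e) < 1 / 2" if "2 * K < z powr e" "0 < z" for K z e :: real
      using that by (simp add: powr_minus field_simps)
    have "C * h powr (- (w - y)) < 1 / 2"
      using X1(2)[of h] Xh Xge by (intro half) auto
    moreover have "C * D ^ n * X powr (- (\<nu> - y)) < 1 / 2"
      using X2(2)[of X] Xge by (intro half) auto
    ultimately show ?thesis by (simp add: distrib_left mult.assoc)
  qed
  finally show False by simp
qed

text \<open>The height bound for \<open>Q\<close> is chosen so that the first term in the resultant
  inequality equals \<open>1/2\<close>.\<close>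

lemma no_uniform_approx:
  assumes tr: "\<not> algebraic \<zeta>" and p: "0 < p" and n: "0 < n" and w: "real n - 1 < w"
    and P: "\<And>B. \<exists>P. irreducible P \<and> degree P = p \<and> B \<le> poly_height P \<and> \<bar>rpoly P \<zeta>\<bar> \<le> poly_height P powr (-w)"
    and Q: "\<And>X. X0 \<le> X \<Longrightarrow> \<exists>Q. Q \<noteq> 0 \<and> degree Q \<le> n \<and> poly_height Q \<le> X \<and> \<bar>rpoly Q \<zeta>\<bar> \<le> X powr (-\<nu>) \<and>
          (\<forall>P. irreducible P \<longrightarrow> degree P = p \<longrightarrow> P dvd Q \<longrightarrow> \<bar>rpoly P \<zeta>\<bar> \<le> \<bar>rpoly Q \<zeta>\<bar>)"
    and \<nu>: "real p < \<nu>" "real p * w < \<nu> * (w - real n + 1)"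
      "real p * real n < (w - real n + 1) * (\<nu> - real p + 1)"
  shows False
proof -
  define C where "C = (fact (p + n) * max 1 \<bar>\<zeta>\<bar> ^ (p + n) :: real)"
  define k where "k = ln (2 * C)"
  have C: "0 < C" by (simp add: C_def)
  \<comment> \<open>\<open>a\<close>, \<open>b\<close> and \<open>e\<close> are the slacks in the
    assumptions. The three terms of \<open>L0\<close> give the contradiction for
    \<open>P dvd Q\<close>, the one for coprime \<open>P\<close> and \<open>Q\<close>, and the
    inequality \<open>X0 \<le> X\<close>.\<close>
  define a where "a = \<nu> * (w - real n + 1) - real p * w"
  define b where "b = (w - real n + 1) * (\<nu> - real p + 1) - real p * real n"
  define e where "e = w - real n + 1"
  have pos: "0 < a" "0 < b" "0 < e" using \<nu> w by (auto simp: a_def b_def e_def)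
  define L0 where "L0 = max (max (\<nu> * k / a) ((real p + (\<nu> - real p + 1)) * k / b))
     ((real p * ln (max X0 1) + k) / e)"
  obtain P where P: "irreducible P" "degree P = p" "exp (L0 + 1) \<le> poly_height P"
      "\<bar>rpoly P \<zeta>\<bar> \<le> poly_height P powr (-w)"
    using P[of "exp (L0 + 1)"] by blast
  define h where "h = poly_height P"
  define L where "L = ln h"
  define t where "t = \<bar>rpoly P \<zeta>\<bar>"
  define T where "T = - ln t"
  have P0: "P \<noteq> 0" using P by auto
  have h1: "1 \<le> h" unfolding h_def by (rule height_ge_1[OF P0])
  have hL: "h = exp L" using h1 by (simp add: L_def)
  have t0: "0 < t" using rpoly_nonzero[OF tr P0] by (simp add: t_def)
  have tT: "t = exp (-T)" using t0 by (simp add: T_def)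
  have "L0 + 1 \<le> L" using P(3) by (simp add: h_def[symmetric] hL)
  then have L: "\<nu> * k / a < L" "(real p + (\<nu> - real p + 1)) * k / b < L" "(real p * ln (max X0 1) + k) / e < L"
    unfolding L0_def by linarith+
  have "exp (-T) \<le> exp (-(w * L))"
    using P(4) h1 by (simp add: h_def[symmetric] t_def[symmetric] tT powr_def L_def)
  then have T: "w * L \<le> T" by simp
  \<comment> \<open>Logarithm of the height bound, solved from
    \<open>C * h ^ (n - 1) * X ^ p * t = 1 / 2\<close>.\<close>
  define x where "x = (T - (real n - 1) * L - k) / real p"
  define X where "X = exp x"
  have px: "real p * x = T - (real n - 1) * L - k" using p by (simp add: x_def)
  have px_ge: "e * L - k \<le> real p * x" using T unfolding px e_def by (simp add: algebra_simps)
  have "real p * ln (max X0 1) < real p * x"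
    using L(3) pos px_ge by (simp add: divide_less_eq mult.commute)
  then have "ln (max X0 1) < x" using p by simp
  then have "ln (max X0 1) < ln X" by (simp add: X_def)
  then have "max X0 1 < X" by (subst (asm) ln_less_cancel_iff) (auto simp: X_def)
  then have X0X: "X0 \<le> X" by simp
  obtain Q where Q: "Q \<noteq> 0" "degree Q \<le> n" "poly_height Q \<le> X" "\<bar>rpoly Q \<zeta>\<bar> \<le> X powr (-\<nu>)"
      "P dvd Q \<Longrightarrow> t \<le> \<bar>rpoly Q \<zeta>\<bar>"
    using Q[OF X0X] P(1,2) unfolding t_def by blast
  have Xnu: "X powr (-\<nu>) = exp (-(\<nu> * x))" by (simp add: X_def powr_def)
  show False
  proof (cases "P dvd Q")
    case True
    \<comment> \<open>Divisibility gives \<open>t \<le> X powr (-\<nu>)\<close>, that is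
      \<open>\<nu> * x \<le> T\<close>. As \<open>\<nu>\<close> exceeds \<open>p\<close>, inserting
      \<open>w * L \<le> T\<close> leaves \<open>a * L\<close> bounded by a constant.\<close>
    then have "exp (-T) \<le> exp (-(\<nu> * x))" using order_trans[OF Q(5) Q(4)] unfolding Xnu tT by blast
    then have "real p * (\<nu> * x) \<le> real p * T" using p by simp
    then have "\<nu> * (T - (real n - 1) * L - k) \<le> real p * T"
      unfolding px[symmetric] by (simp only: mult_ac)
    then have "(\<nu> - real p) * T \<le> \<nu> * (real n - 1) * L + \<nu> * k" by (simp add: algebra_simps)
    moreover have "(\<nu> - real p) * (w * L) \<le> (\<nu> - real p) * T"
      using T \<nu>(1) by (intro mult_left_mono) auto
    ultimately have "a * L \<le> \<nu> * k" by (simp add: a_def algebra_simps)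
    then show False using L(1) pos by (simp add: divide_less_eq mult.commute)
  next
    case False
    have 1: "1 \<le> C * (h ^ (n - 1) * X ^ p * t + h ^ n * X ^ (p - 1) * \<bar>rpoly Q \<zeta>\<bar>)"
      using coprime_height_bound[OF P(1) False P(2) p Q(2) n Q(3), of \<zeta>] by (simp add: C_def h_def t_def)
    have pow: "h ^ j = exp (real j * L)" "X ^ j = exp (real j * x)" for j
      by (simp_all add: hL X_def exp_of_nat_mult)
    have C2: "C = exp k / 2" using C by (simp add: k_def)
    have rn: "real (n - 1) = real n - 1" "real (p - 1) = real p - 1" using n p by auto
    \<comment> \<open>The first summand is exactly one half, so the second is at least one half;
      this bounds \<open>x\<close> from above, while \<open>px_ge\<close> bounds it from
      below.\<close>
    have "C * (h ^ (n - 1) * X ^ p * t) = exp (k + (real n - 1) * L + real p * x + -T) / 2"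
      by (simp only: pow tT C2 rn exp_add times_divide_eq_left mult.assoc)
    also have "\<dots> = 1 / 2" by (simp add: px)
    finally have "1 / 2 \<le> C * (h ^ n * X ^ (p - 1) * \<bar>rpoly Q \<zeta>\<bar>)"
      using 1 by (simp add: distrib_left)
    also have "\<dots> \<le> C * (h ^ n * X ^ (p - 1) * exp (-(\<nu> * x)))"
      using Q(4) C h1 Xnu by (intro mult_left_mono) (auto simp: X_def)
    also have "\<dots> = exp (k + real n * L + (real p - 1) * x + -(\<nu> * x)) / 2"
      by (simp only: pow C2 rn exp_add times_divide_eq_left mult.assoc)
    finally have "(\<nu> - real p + 1) * x \<le> k + real n * L" by (simp add: algebra_simps)
    then have "(\<nu> - real p + 1) * (real p * x) \<le> real p * (k + real n * L)"
      using p by (metis mult.left_commute mult_left_mono of_nat_0_le_iff)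
    moreover have "(\<nu> - real p + 1) * (e * L - k) \<le> (\<nu> - real p + 1) * (real p * x)"
      using px_ge \<nu>(1) by (intro mult_left_mono) auto
    ultimately have "b * L \<le> (real p + (\<nu> - real p + 1)) * k"
      by (simp add: b_def e_def algebra_simps)
    then show False using L(2) pos by (simp add: divide_less_eq mult.commute)
  qed
qed

section \<open>Approximation by algebraic numbers\<close>

text \<open>Induction through the splitting
  \<open>a * (a ^ i - b ^ i) + b ^ i * (a - b)\<close>.\<close>

lemma abs_power_diff_le:
  fixes a b M :: real
  assumes "\<bar>a\<bar> \<le> M" "\<bar>b\<bar> \<le> M" "1 \<le> M"
  shows "\<bar>a ^ i - b ^ i\<bar> \<le> real i * M ^ i * \<bar>a - b\<bar>"
proof (induction i)
  case (Suc i)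
  have bi: "\<bar>b\<bar> ^ i \<le> M ^ Suc i"
  proof -
    have "\<bar>b\<bar> ^ i \<le> M ^ i" using assms by (intro power_mono) auto
    also have "\<dots> \<le> M ^ Suc i" using assms by (intro power_increasing) auto
    finally show ?thesis .
  qed
  have "a ^ Suc i - b ^ Suc i = a * (a ^ i - b ^ i) + b ^ i * (a - b)"
    by (simp add: algebra_simps)
  then have "\<bar>a ^ Suc i - b ^ Suc i\<bar> \<le> \<bar>a\<bar> * \<bar>a ^ i - b ^ i\<bar> + \<bar>b\<bar> ^ i * \<bar>a - b\<bar>"
    by (metis abs_mult abs_triangle_ineq power_abs)
  also have "\<dots> \<le> M * (real i * M ^ i * \<bar>a - b\<bar>) + M ^ Suc i * \<bar>a - b\<bar>"
    using assms Suc bi by (intro add_mono mult_mono) auto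
  also have "\<dots> = real (Suc i) * M ^ Suc i * \<bar>a - b\<bar>" by (simp add: algebra_simps)
  finally show ?case .
qed simp

text \<open>Subtract the zero value at \<open>\<alpha>\<close> and compare monomials; both points
  have modulus at most \<open>\<bar>\<zeta>\<bar> + 1\<close>.\<close>

lemma abs_rpoly_le_near_root:
  assumes "rpoly Q \<alpha> = 0" "degree Q \<le> n" "\<bar>\<zeta> - \<alpha>\<bar> \<le> 1"
  shows "\<bar>rpoly Q \<zeta>\<bar> \<le> (\<Sum>i\<le>n. real i * (\<bar>\<zeta>\<bar> + 1) ^ i) * (poly_height Q * \<bar>\<zeta> - \<alpha>\<bar>)"
proof -
  have "rpoly Q \<zeta> = rpoly Q \<zeta> - rpoly Q \<alpha>" using assms by simp
  also have "\<dots> = (\<Sum>i\<le>n. of_int (coeff Q i) * (\<zeta> ^ i - \<alpha> ^ i))"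
    by (simp add: rpoly_eq_sum[OF assms(2)] sum_subtractf right_diff_distrib)
  also have "\<bar>\<dots>\<bar> \<le> (\<Sum>i\<le>n. \<bar>of_int (coeff Q i) * (\<zeta> ^ i - \<alpha> ^ i)\<bar>)" by (rule sum_abs)
  also have "\<dots> \<le> (\<Sum>i\<le>n. poly_height Q * (real i * (\<bar>\<zeta>\<bar> + 1) ^ i * \<bar>\<zeta> - \<alpha>\<bar>))"
  proof (rule sum_mono)
    fix i
    have "\<bar>\<zeta> ^ i - \<alpha> ^ i\<bar> \<le> real i * (\<bar>\<zeta>\<bar> + 1) ^ i * \<bar>\<zeta> - \<alpha>\<bar>"
      using assms(3) by (intro abs_power_diff_le) auto
    moreover have c: "\<bar>real_of_int (coeff Q i)\<bar> \<le> poly_height Q"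
      using abs_coeff_le_int_height[of Q i] by linarith
    moreover have "0 \<le> poly_height Q" using c abs_ge_zero order_trans by blast
    ultimately show "\<bar>of_int (coeff Q i) * (\<zeta> ^ i - \<alpha> ^ i)\<bar> \<le> poly_height Q * (real i * (\<bar>\<zeta>\<bar> + 1) ^ i * \<bar>\<zeta> - \<alpha>\<bar>)"
      unfolding abs_mult by (intro mult_mono) auto
  qed
  also have "\<dots> = (\<Sum>i\<le>n. real i * (\<bar>\<zeta>\<bar> + 1) ^ i) * (poly_height Q * \<bar>\<zeta> - \<alpha>\<bar>)"
    unfolding sum_distrib_right by (intro sum.cong) (auto simp: mult_ac)
  finally show ?thesis .
qed

text \<open>The choice in \<open>min_int_poly\<close> needs a witness: some irreducible factor of an
  integer polynomial vanishing at \<open>\<alpha>\<close> also vanishes there, and its sign can be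
  normalised.\<close>

lemma min_int_poly_irreducible_root:
  assumes "algebraic \<alpha>"
  shows "irreducible (min_int_poly \<alpha>)" "rpoly (min_int_poly \<alpha>) \<alpha> = 0"
proof -
  obtain p where p: "\<forall>i. coeff p i \<in> \<int>" "p \<noteq> 0" "poly p \<alpha> = 0"
    using assms unfolding algebraic_def by blast
  define P where "P = map_poly floor p"
  have P: "p = map_poly of_int P"
    using p(1) by (intro poly_eqI) (auto simp: P_def coeff_map_poly)
  have "\<exists>F. irreducible F \<and> rpoly F \<alpha> = 0" if "P \<noteq> 0" "rpoly P \<alpha> = 0" for P
    using that
  proof (induction P rule: prime_divisors_induct)
    case (unit x)
    then have "degree x = 0" by (simp add: poly_dvd_1)
    then show ?case using abs_rpoly_const_ge_1[of x \<alpha>] unit by simp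
  next
    case (factor p x)
    then show ?case using prime_elem_imp_irreducible[of p] by (auto simp: rpoly_mult)
  qed simp
  then obtain F where F: "irreducible F" "rpoly F \<alpha> = 0"
    using p P by (auto simp: rpoly_def)
  define G where "G = (if lead_coeff F > 0 then F else - F)"
  have "F \<noteq> 0" using F by auto
  moreover have "irreducible (- F)"
    using F(1) irreducible_mult_unit_left[of "- 1" F] by simp
  ultimately have "irreducible G \<and> lead_coeff G > 0 \<and> rpoly G \<alpha> = 0"
    using F leading_coeff_0_iff[of F]
    by (auto simp: G_def rpoly_def of_int_poly_hom.hom_uminus not_less_iff_gr_or_eq)
  then have "irreducible (min_int_poly \<alpha>) \<and> lead_coeff (min_int_poly \<alpha>) > 0 \<and> rpoly (min_int_poly \<alpha>) \<alpha> = 0"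
    unfolding min_int_poly_def by (rule someI)
  then show "irreducible (min_int_poly \<alpha>)" "rpoly (min_int_poly \<alpha>) \<alpha> = 0" by auto
qed

text \<open>The minimal polynomial of a close algebraic number is small at \<open>\<zeta>\<close>,
  up to a constant absorbed by lowering the exponent from \<open>\<mu>\<close> to
  \<open>\<nu>\<close>. The gain over \<open>w_hat_greaterD\<close> is irreducibility.\<close>

lemma w_hat_star_greaterD:
  assumes w: "0 \<le> w" "ereal w < w_hat_star n \<zeta>"
  shows "\<exists>\<nu>>w. \<exists>X0. \<forall>X\<ge>X0. \<exists>Q. irreducible Q \<and> degree Q \<le> n \<and> poly_height Q \<le> X \<and>
    \<bar>rpoly Q \<zeta>\<bar> \<le> X powr (-\<nu>)"
proof -
  obtain \<mu> X0 where \<mu>: "w < \<mu>" and \<alpha>: "\<forall>X\<ge>X0. \<exists>\<alpha>::real.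
      algebraic \<alpha> \<and> alg_degree \<alpha> \<le> n \<and> real_of_int (alg_height \<alpha>) \<le> X \<and>
      0 < \<bar>\<zeta> - \<alpha>\<bar> \<and> \<bar>\<zeta> - \<alpha>\<bar> \<le> (1 / real_of_int (alg_height \<alpha>)) * X powr (-\<mu>)"
    using w(2) unfolding w_hat_star_def less_Sup_iff by auto
  define \<nu> where "\<nu> = (w + \<mu>) / 2"
  have \<nu>: "w < \<nu>" "\<nu> < \<mu>" using \<mu> by (auto simp: \<nu>_def)
  define K where "K = (\<Sum>i\<le>n. real i * (\<bar>\<zeta>\<bar> + 1) ^ i)"
  have K: "0 \<le> K" unfolding K_def by (intro sum_nonneg) auto
  obtain X1 where X1: "1 \<le> X1" "\<And>X. X1 \<le> X \<Longrightarrow> K < X powr (\<mu> - \<nu>)"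
    using powr_dominates[of "\<mu> - \<nu>" K] \<nu> by auto
  have "\<exists>Q. irreducible Q \<and> degree Q \<le> n \<and> poly_height Q \<le> X \<and> \<bar>rpoly Q \<zeta>\<bar> \<le> X powr (-\<nu>)"
    if X: "max X0 X1 \<le> X" for X
  proof -
    obtain \<alpha> where a: "algebraic \<alpha>" "alg_degree \<alpha> \<le> n" "real_of_int (alg_height \<alpha>) \<le> X"
      "\<bar>\<zeta> - \<alpha>\<bar> \<le> (1 / real_of_int (alg_height \<alpha>)) * X powr (-\<mu>)"
      using \<alpha> X by auto
    define Q where "Q = min_int_poly \<alpha>"
    have Q: "irreducible Q" "rpoly Q \<alpha> = 0" "degree Q \<le> n" "poly_height Q \<le> X"
      using min_int_poly_irreducible_root[OF a(1)] a(2,3)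
      by (auto simp: Q_def alg_degree_def alg_height_def)
    have h1: "1 \<le> poly_height Q" using Q by (intro height_ge_1) auto
    have XX: "1 \<le> X" using X X1 by simp
    have le: "\<bar>\<zeta> - \<alpha>\<bar> \<le> (1 / poly_height Q) * X powr (-\<mu>)"
      using a(4) by (simp add: Q_def alg_height_def)
    have "X powr (-\<mu>) \<le> X powr 0" using \<mu> w XX by (intro powr_mono) auto
    then have "(1 / poly_height Q) * X powr (-\<mu>) \<le> 1 * 1"
      using h1 XX by (intro mult_mono) auto
    then have near: "\<bar>\<zeta> - \<alpha>\<bar> \<le> 1" using le by simp
    have "\<bar>rpoly Q \<zeta>\<bar> \<le> K * (poly_height Q * \<bar>\<zeta> - \<alpha>\<bar>)"
      unfolding K_def by (rule abs_rpoly_le_near_root[OF Q(2,3) near])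
    also have "poly_height Q * \<bar>\<zeta> - \<alpha>\<bar> \<le> X powr (-\<mu>)"
      using le h1 by (simp add: field_simps)
    then have "K * (poly_height Q * \<bar>\<zeta> - \<alpha>\<bar>) \<le> X powr (\<mu> - \<nu>) * X powr (-\<mu>)"
      using K X1(2)[of X] X h1 by (intro mult_mono) auto
    also have "\<dots> = X powr (-\<nu>)" by (simp flip: powr_add)
    finally show ?thesis using Q by blast
  qed
  then show ?thesis using \<nu> by blast
qed

lemma w_hat_greater_of_star:
  assumes "0 \<le> w" "ereal w < w_hat_star n \<zeta>"
  shows "ereal w < w_hat n \<zeta>"
proof -
  obtain \<nu> X0 where \<nu>: "w < \<nu>" and Q: "\<forall>X\<ge>X0. \<exists>Q. irreducible Q \<and> degree Q \<le> n \<and> poly_height Q \<le> X \<and>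
    \<bar>rpoly Q \<zeta>\<bar> \<le> X powr (-\<nu>)"
    using w_hat_star_greaterD[OF assms] by blast
  have "ereal \<nu> \<le> w_hat n \<zeta>"
  proof (rule w_hat_geI)
    fix X assume "X0 \<le> X"
    then obtain Q where "irreducible Q" "degree Q \<le> n" "poly_height Q \<le> X" "\<bar>rpoly Q \<zeta>\<bar> \<le> X powr (-\<nu>)"
      using Q by blast
    then show "\<exists>P. P \<noteq> 0 \<and> degree P \<le> n \<and> poly_height P \<le> X \<and> \<bar>rpoly P \<zeta>\<bar> \<le> X powr (-\<nu>)"
      using not_irreducible_zero by blast
  qed
  then show ?thesis using \<nu> by (meson ereal_less_eq(3) less_ereal.simps(1) less_le_trans)
qed

text \<open>The cofactor is a nonzero integer constant. This provides the divisibility clause of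
  \<open>no_uniform_approx\<close> for \<open>p = n\<close>.\<close>

lemma abs_rpoly_dvd_same_degree:
  assumes "P dvd Q" "Q \<noteq> 0" "degree Q \<le> degree P"
  shows "\<bar>rpoly P x\<bar> \<le> \<bar>rpoly Q x\<bar>"
proof -
  from assms obtain R where R: "Q = P * R" by (auto elim: dvdE)
  then have "degree Q = degree P + degree R" using assms by (auto simp: degree_mult_eq)
  then have "1 \<le> \<bar>rpoly R x\<bar>" using R assms by (intro abs_rpoly_const_ge_1) auto
  then show ?thesis
    using mult_left_mono[of 1 "\<bar>rpoly R x\<bar>" "\<bar>rpoly P x\<bar>"] by (simp add: R rpoly_mult abs_mult)
qed

text \<open>The cofactor is a unit. This provides the divisibility clause for
  \<open>p = n - 1\<close>, where degrees alone would allow a linear cofactor.\<close>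

lemma abs_rpoly_dvd_irreducible:
  assumes "irreducible P" "irreducible Q" "P dvd Q"
  shows "\<bar>rpoly P x\<bar> \<le> \<bar>rpoly Q x\<bar>"
proof -
  from assms obtain R where R: "Q = P * R" by (auto elim: dvdE)
  then have "R dvd 1" using assms by (auto dest: irreducibleD)
  then have "degree R = 0" by (simp add: poly_dvd_1)
  then have "degree Q \<le> degree P" using R degree_mult_le[of P R] by simp
  then show ?thesis using assms by (intro abs_rpoly_dvd_same_degree) auto
qed


section \<open>The function \<open>phi\<close> and the constant \<open>Delta\<close>\<close>

text \<open>For \<open>y \<noteq> w\<close>, dividing the equation \<open>w - y + 1 = (w/y)^n\<close> by \<open>w/y - 1\<close> turns it into
  \<open>(\<Sum>j<n. (w/y)^j) = y\<close>, whose left-hand side decreases in \<open>y\<close>.\<close>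

lemma phi_equation_iff:
  fixes r y :: real
  assumes "0 < y" "y < r"
  shows "r - y + 1 = (r / y) ^ n \<longleftrightarrow> (\<Sum>j<n. (r / y) ^ j) = y"
proof -
  have u: "r / y - 1 \<noteq> 0" using assms by (simp add: field_simps)
  have "(r / y) ^ n - 1 = (r / y - 1) * (\<Sum>j<n. (r / y) ^ j)"
    by (rule power_diff_1_eq)
  moreover have "r - y = (r / y - 1) * y" using assms by (simp add: field_simps)
  ultimately have "r - y + 1 = (r / y) ^ n \<longleftrightarrow>
      (r / y - 1) * (\<Sum>j<n. (r / y) ^ j) = (r / y - 1) * y"
    by argo
  then show ?thesis using u by (metis mult_left_cancel)
qed

lemma geometric_sum_quotient_antimono:
  fixes r x y :: real
  assumes "0 \<le> r" "0 < x" "x \<le> y"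
  shows "(\<Sum>j<n. (r / y) ^ j) \<le> (\<Sum>j<n. (r / x) ^ j)"
  using assms by (intro sum_mono power_mono divide_left_mono) auto

text \<open>The function \<open>h\<close> is strictly increasing, with \<open>h n \<le> 0\<close>
  since all quotients are at least 1 there, and \<open>h r = r - n > 0\<close>. Its unique zero is
  what the definite description in \<open>phi\<close> denotes.\<close>

lemma phi_solution:
  fixes r :: real
  assumes n: "0 < n" and r: "real n < r"
  obtains y where "real n \<le> y" "y < r" "(\<Sum>j<n. (r / y) ^ j) = y"
    "phi n (ereal r) = ereal y"
proof -
  define h where "h y = y - (\<Sum>j<n. (r / y) ^ j)" for y
  have r0: "0 < r" using r by linarith
  have strict: "h x < h y" if "0 < x" "x < y" for x y
    using geometric_sum_quotient_antimono[of r x y n] that r0 by (simp add: h_def)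
  have "(\<Sum>j<n. (1::real)) \<le> (\<Sum>j<n. (r / real n) ^ j)"
    using n r by (intro sum_mono one_le_power) (auto simp: field_simps)
  then have hn: "h (real n) \<le> 0" by (simp add: h_def)
  have hr: "0 < h r" using r r0 by (simp add: h_def)
  have "continuous_on {real n..r} h"
    unfolding h_def using n by (intro continuous_intros) auto
  then obtain y where y: "real n \<le> y" "y \<le> r" "h y = 0"
    using IVT'[of h "real n" 0 r] hn hr r by auto
  have yr: "y < r" using y hr by (cases "y = r") auto
  have y0: "0 < y" using y n by linarith
  have "(THE z. real n \<le> z \<and> z < r \<and> r - z + 1 = (r / z) ^ n) = y"
  proof (rule the_equality)
    show "real n \<le> y \<and> y < r \<and> r - y + 1 = (r / y) ^ n"
      using y yr y0 phi_equation_iff[of y r n] by (auto simp: h_def)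
    fix z assume z: "real n \<le> z \<and> z < r \<and> r - z + 1 = (r / z) ^ n"
    then have z0: "0 < z" using n by linarith
    then have "h z = 0" using z phi_equation_iff[of z r n] by (simp add: h_def)
    then show "z = y" using strict[of z y] strict[of y z] z0 y0 y(3)
      by (cases z y rule: linorder_cases) auto
  qed
  then have "phi n (ereal r) = ereal y" using r by (simp add: phi_def)
  moreover have "(\<Sum>j<n. (r / y) ^ j) = y" using y(3) by (simp add: h_def)
  ultimately show thesis using that[OF y(1) yr] by blast
qed

text \<open>A value \<open>y > y0\<close> of \<open>phi\<close> would, by monotonicity of the sum,
  satisfy \<open>y \<le> (\<Sum>j<n. s ^ j) \<le> y0\<close>.\<close>

lemma phi_le:
  fixes y0 s :: real
  assumes n: "0 < n" and y0: "real n \<le> y0"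
    and s: "(\<Sum>j<n. s ^ j) \<le> y0" and w: "w \<le> ereal (s * y0)"
  shows "phi n w \<le> ereal y0"
proof (cases "w \<le> ereal (real n)")
  case True
  then show ?thesis using y0 by (auto simp: phi_def)
next
  case False
  then obtain r where r: "w = ereal r" "real n < r"
    using w by (cases w) auto
  have pos: "0 < y0" "0 < r" using n y0 r by linarith+
  obtain y where y: "real n \<le> y" "y < r" "(\<Sum>j<n. (r / y) ^ j) = y" "phi n w = ereal y"
    using phi_solution[OF n r(2)] r by metis
  have "y \<le> y0"
  proof (rule ccontr)
    assume c: "\<not> y \<le> y0"
    then have "y \<le> (\<Sum>j<n. (r / y0) ^ j)"
      using geometric_sum_quotient_antimono[of r y0 y n] pos y(3) by simp
    also have "\<dots> \<le> (\<Sum>j<n. s ^ j)"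
      using w r pos by (intro sum_mono power_mono) (auto simp: field_simps)
    finally show False using c s by simp
  qed
  then show ?thesis using y by simp
qed

section \<open>The constants tau and Delta\<close>

lemma tau_equation_unique:
  fixes s t :: real
  assumes "1 < s" "1 < t" "s - ln s = t - ln t"
  shows "s = t"
proof -
  \<comment> \<open>\<open>t - ln t\<close> is strictly increasing beyond 1.\<close>
  have *: "a - ln a < b - ln b" if "1 < a" "a < b" for a b :: real
  proof -
    have "ln (b / a) \<le> b / a - 1" using that by (intro ln_le_minus_one) auto
    also have "\<dots> = (b - a) / a" using that by (simp add: field_simps)
    also have "\<dots> < (b - a) / 1" using that by (intro divide_strict_left_mono) auto
    finally show ?thesis using that by (simp add: ln_div)
  qed
  then show ?thesis using *[of s t] *[of t s] assms by linarith
qed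

text \<open>With \<open>t = 1 / tau\<close> the defining equation reads
  \<open>t - ln t = ln 2 + 1/2\<close>. Hence \<open>Delta - 1 = ln (2 * t) = t - 1/2\<close>, and
  exponentiating gives the first claim; locating \<open>t\<close> between 1 and 5/2 gives the
  others.\<close>

lemma Delta_properties:
  "exp (Delta - 1) = 1 + 2 * (Delta - 1)" "0 < Delta - 1" "Delta < 3"
proof -
  define f :: "real \<Rightarrow> real" where "f t = t - ln t" for t
  have e2: "(5::real) < exp 2"
  proof -
    have "(5/2::real)\<^sup>2 \<le> (exp 1)\<^sup>2"
      using exp_lower_Taylor_quadratic[of 1] by (intro power_mono) auto
    then show ?thesis by (simp add: power2_eq_square flip: exp_add)
  qed
  have e1: "1/2 < ln (2::real)"
  proof -
    have "exp (1/2) < (2::real)"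
      using exp_le power2_less_imp_less[of "exp (1/2)" "2::real"]
      by (simp add: power2_eq_square flip: exp_add)
    then show ?thesis using ln_less_cancel_iff[of "exp (1/2)" 2] by simp
  qed
  have "f 1 < ln 2 + 1/2" using e1 by (simp add: f_def)
  moreover have "ln 2 + 1/2 < f (5/2)"
  proof -
    have "ln 5 < (2::real)" using e2 by (metis exp_gt_zero exp_less_cancel_iff exp_ln zero_less_numeral)
    then show ?thesis by (simp add: f_def ln_div)
  qed
  moreover have "continuous_on {1..5/2} f"
    unfolding f_def by (intro continuous_intros) auto
  ultimately obtain t where t: "1 \<le> t" "t \<le> 5/2" "f t = ln 2 + 1/2"
    using IVT'[of f 1 "ln 2 + 1/2" "5/2"] by auto
  have t1: "1 < t" using t \<open>f 1 < ln 2 + 1/2\<close> by (cases "t = 1") auto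
  have t2: "t < 5/2" using t \<open>ln 2 + 1/2 < f (5/2)\<close> by (cases "t = 5/2") auto
  have iff: "y * exp (1 / y) = 2 * sqrt (exp 1) \<longleftrightarrow> f (1 / y) = ln 2 + 1/2" if "0 < y" for y
  proof -
    have sq: "sqrt (exp 1) = exp (1/2::real)"
      by (rule real_sqrt_unique) (auto simp: power2_eq_square simp flip: exp_add)
    have "y * exp (1 / y) = 2 * sqrt (exp 1) \<longleftrightarrow> ln (y * exp (1 / y)) = ln (2 * exp (1/2))"
      unfolding sq using that by (subst ln_inj_iff) auto
    also have "\<dots> \<longleftrightarrow> f (1 / y) = ln 2 + 1/2"
      using that by (auto simp: ln_mult f_def ln_div)
    finally show ?thesis .
  qed
  have tau: "tau = 1 / t"
    unfolding tau_def
  proof (rule the_equality)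
    show "0 < 1 / t \<and> 1 / t < 1 \<and> 1 / t * exp (1 / (1 / t)) = 2 * sqrt (exp 1)"
      using iff[of "1 / t"] t t1 by auto
    fix y :: real
    assume y: "0 < y \<and> y < 1 \<and> y * exp (1 / y) = 2 * sqrt (exp 1)"
    then have "1 / y = t"
      using tau_equation_unique[of "1 / y" t] iff[of y] t t1 by (auto simp: f_def)
    then show "y = 1 / t" using y by auto
  qed
  have "2 / tau = 2 * t" by (simp add: tau del: mult_eq_0_iff)
  then have D: "Delta - 1 = ln (2 * t)" using t1 by (simp add: Delta_def)
  also have "\<dots> = t - 1/2"
    using t t1 by (simp add: ln_mult f_def)
  finally have D': "Delta - 1 = t - 1/2" .
  show "exp (Delta - 1) = 1 + 2 * (Delta - 1)"
    using D D' t1 by simp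
  show "0 < Delta - 1" "Delta < 3" using D' t1 t2 by linarith+
qed

section \<open>Estimates of the geometric sum at the crossing\<close>

lemma exp_less_1_plus_double:
  fixes a c :: real
  assumes "exp c = 1 + 2 * c" "0 < a" "a < c"
  shows "exp a < 1 + 2 * a"
proof -
  \<comment> \<open>Strict convexity: the tangent of \<open>exp\<close> at \<open>a\<close> lies
    below \<open>exp\<close> at 0 and at \<open>c\<close>, and the weights \<open>1 - l\<close> and
    \<open>l\<close> recombine the two tangent values to \<open>exp a\<close>.\<close>
  define l where "l = a / c"
  have l: "0 < l" "l < 1" "l * c = a" using assms by (auto simp: l_def)
  have "exp a * (1 - a) \<le> exp a * exp (- a)"
    using exp_ge_add_one_self[of "- a"] by (intro mult_left_mono) auto
  then have 1: "exp a * (1 - a) \<le> 1" by (simp flip: exp_add)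
  have "exp a * (1 + (c - a)) < exp a * exp (c - a)"
  proof (rule mult_strict_left_mono)
    have "0 < (c - a)\<^sup>2" using assms by simp
    then show "1 + (c - a) < exp (c - a)"
      using exp_lower_Taylor_quadratic[of "c - a"] assms by linarith
  qed simp
  then have 2: "exp a * (1 + (c - a)) < 1 + 2 * c" using assms by (simp flip: exp_add)
  have "exp a = (1 - l) * (exp a * (1 - a)) + l * (exp a * (1 + (c - a)))"
    using l(3) by (auto simp: algebra_simps)
  also have "\<dots> < (1 - l) * 1 + l * (1 + 2 * c)"
    using 1 2 l by (intro add_le_less_mono mult_left_mono mult_strict_left_mono) auto
  also have "\<dots> = 1 + 2 * a" using l(3) by (simp add: algebra_simps)
  finally show ?thesis .
qed

text \<open>The base is \<open>(n - 1) / (y - n)\<close> for \<open>y = 2 * n - 1 - a\<close>, and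
  its \<open>n\<close>-th power tends to \<open>exp a\<close>. So the sum divided by
  \<open>y\<close> tends to \<open>(exp a - 1) / (2 * a) < 1\<close>.\<close>

lemma eventually_geometric_sum_le:
  fixes a :: real
  assumes a: "0 < a" "exp a < 1 + 2 * a"
  shows "\<forall>\<^sub>F n in sequentially.
    (\<Sum>j<n. ((real n - 1) / (real n - 1 - a)) ^ j) \<le> 2 * real n - 1 - a"
proof -
  have "((\<lambda>n. (((real n - 1) / (real n - 1 - a)) powr real n - 1) * ((real n - 1 - a) / a) / (2 * real n - 1 - a))
     \<longlongrightarrow> (exp a - 1) * inverse a / 2) sequentially"
    using a by real_asymp
  moreover have "(exp a - 1) * inverse a / 2 < 1" using a by (simp add: field_simps)
  ultimately have "\<forall>\<^sub>F n in sequentially. (((real n - 1) / (real n - 1 - a)) powr real n - 1) * ((real n - 1 - a) / a) / (2 * real n - 1 - a) < 1"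
    by (rule order_tendstoD)
  moreover have "\<forall>\<^sub>F n in sequentially. 1 + a < real n" by real_asymp
  ultimately show ?thesis
  proof eventually_elim
    case (elim n)
    let ?s = "(real n - 1) / (real n - 1 - a)"
    have n: "0 < real n - 1 - a" using elim by simp
    have s: "?s - 1 = a / (real n - 1 - a)" using n by (simp add: field_simps)
    have "?s powr real n = ?s ^ n" using n a by (intro powr_realpow divide_pos_pos) auto
    then have "(?s ^ n - 1) * ((real n - 1 - a) / a) < 2 * real n - 1 - a"
      using elim n a by (simp add: divide_less_eq mult.commute)
    moreover have "(\<Sum>j<n. ?s ^ j) = (?s ^ n - 1) * ((real n - 1 - a) / a)"
      using power_diff_1_eq[of ?s n] s n a by (simp add: field_simps)
    ultimately show ?case by simp
  qed
qed

text \<open>The quotient of the two bases is \<open>1 + 1 / (k * (k + 2))\<close>, and Bernoulli's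
  inequality shows that its power \<open>k + 2\<close> outweighs the extra factor
  \<open>b\<close>.\<close>

lemma one_plus_inverse_power_decreasing:
  fixes k :: nat
  assumes "0 < k"
  shows "(1 + 1 / real (Suc k)) ^ (Suc k + 2) \<le> (1 + 1 / real k) ^ (k + 2)"
proof -
  define b where "b = 1 + 1 / real (Suc k)"
  have b: "1 < b" by (simp add: b_def)
  have k: "0 < real k" using assms by simp
  have q: "(1 + 1 / real k) / b = 1 + 1 / (real k * (real k + 2))"
    using k by (simp add: b_def divide_simps) (simp add: algebra_simps)
  have "1 / real (Suc k) \<le> 1 / real k" using k by (simp add: field_simps)
  also have "\<dots> = real (k + 2) * (1 / (real k * (real k + 2)))"
    using k by (simp add: divide_simps)
  finally have "b \<le> 1 + real (k + 2) * (1 / (real k * (real k + 2)))" by (simp add: b_def)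
  also have "\<dots> \<le> (1 + 1 / (real k * (real k + 2))) ^ (k + 2)"
  proof (rule Bernoulli_inequality)
    have "0 \<le> 1 / (real k * (real k + 2))" using k by simp
    then show "-1 \<le> 1 / (real k * (real k + 2))" by linarith
  qed
  also have "\<dots> = (1 + 1 / real k) ^ (k + 2) / b ^ (k + 2)"
    by (simp add: power_divide flip: q)
  finally have "b * b ^ (k + 2) \<le> (1 + 1 / real k) ^ (k + 2)"
    using b by (simp add: pos_le_divide_eq)
  then show ?thesis by (simp add: b_def)
qed

text \<open>From \<open>k = 15\<close> on the power is at most 3 by monotonicity; smaller
  \<open>k\<close> are computed. The case \<open>k = 8\<close> is tight, about 3.247 against 3.25,
  and the inequality fails at \<open>k = 7\<close>.\<close>

lemma one_plus_inverse_power_le: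
  fixes k :: nat
  assumes "8 \<le> k"
  shows "(1 + 1 / real k) ^ (k + 2) \<le> 3 + 2 / real k"
proof (cases "k \<le> 15")
  case True
  then consider "k = 8" | "k = 9" | "k = 10" | "k = 11" | "k = 12" | "k = 13" | "k = 14" | "k = 15"
    using assms by linarith
  then show ?thesis by cases (simp_all add: field_simps)
next
  case False
  have "(1 + 1 / real k) ^ (k + 2) \<le> 3" if "15 \<le> k" for k
    using that
  proof (induction k rule: dec_induct)
    case base
    show ?case by (simp add: field_simps)
  next
    case (step m)
    then show ?case using one_plus_inverse_power_decreasing[of m] by linarith
  qed
  then show ?thesis using False by (smt (verit) divide_nonneg_nonneg nat_le_linear of_nat_0_le_iff)
qed

lemma geometric_sum_le_2n_minus_2:
  fixes n :: nat
  assumes "10 \<le> n"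
  shows "(\<Sum>j<n. ((real n - 1) / (real n - 2)) ^ j) \<le> 2 * real n - 2"
proof -
  define k where "k = n - 2"
  have n: "n = k + 2" and k: "8 \<le> k" using assms by (auto simp: k_def)
  have k0: "0 < real k" using k by simp
  have s: "(real n - 1) / (real n - 2) = 1 + 1 / real k" using k0 by (simp add: n field_simps)
  have "(1 + 1 / real k) ^ n - 1 = (1 / real k) * (\<Sum>j<n. (1 + 1 / real k) ^ j)"
    using power_diff_1_eq[of "1 + 1 / real k" n] by simp
  then have "(\<Sum>j<n. (1 + 1 / real k) ^ j) = real k * ((1 + 1 / real k) ^ n - 1)"
    using k0 by (simp add: field_simps)
  also have "\<dots> \<le> real k * ((3 + 2 / real k) - 1)"
    using one_plus_inverse_power_le[OF k] k0 unfolding n by (intro mult_left_mono) auto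
  also have "\<dots> = 2 * real k + 2"
    using k0 by (simp add: right_diff_distrib distrib_left)
  also have "\<dots> = 2 * real n - 2" unfolding n by simp
  finally show ?thesis by (simp only: s)
qed

section \<open>Crossing of the two bounds\<close>

text \<open>With \<open>s = (n - 1) / (y - n)\<close> the number \<open>s * y\<close> is the solution \<open>w\<close> of
  \<open>y = n * w / (w - n + 1)\<close>. Below it \<open>phi n\<close> is at most \<open>y\<close>, above it the resultant argument applies.\<close>

context
  fixes n :: nat and \<zeta> y s :: real
  assumes tr: "\<not> algebraic \<zeta>" and n: "2 \<le> n" and y: "real n < y" "y \<le> 2 * real n - 1"
    and s_def: "s = (real n - 1) / (y - real n)"
    and sum_le: "(\<Sum>j<n. s ^ j) \<le> y"
    and SS: "w_hat n \<zeta> \<le> phi n (w_exp n \<zeta>)"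
begin

text \<open>At \<open>w = s * y\<close> and \<open>\<nu> = y\<close> the third inequality is an
  equality, because \<open>s * y - n + 1 = n * s\<close>. The third and fourth conclusions feed
  \<open>no_uniform_approx\<close> for \<open>p = n\<close>, the last two for
  \<open>p = n - 1\<close>.\<close>

lemma crossing_bounds:
  assumes "s * y < w" "y < \<nu>"
  shows "real n - 1 < w" "0 < w" "real n * w < \<nu> * (w - real n + 1)"
    "real n * real n < (w - real n + 1) * (\<nu> - real n + 1)"
    "real n * (real n - 1) < (w - real n + 1) * (\<nu> - (real n - 1) + 1)"
    "(real n - 1) * w < \<nu> * (w - real n + 1)"
proof -
  define d where "d = y - real n"
  have d: "0 < d" "d \<le> real n - 1" using y by (auto simp: d_def)
  have n1: "0 < real n - 1" using n by simp
  have sd: "s * d = real n - 1" using d by (simp add: s_def d_def)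
  have "s * y = s * d + real n * s" by (simp add: d_def algebra_simps)
  then have sy: "s * y = real n - 1 + real n * s" using sd by simp
  have s1: "1 \<le> s" using d n1 by (simp add: s_def d_def[symmetric])
  have e: "real n * s < w - real n + 1" using assms sy by simp
  have ns: "0 < real n * s" using n s1 by simp
  show w1: "real n - 1 < w" using e ns by linarith
  show w0: "0 < w" using w1 n1 by linarith
  have "real n * (real n - 1) = real n * s * d" using sd by simp
  also have "\<dots> < (w - real n + 1) * d" using e d by (intro mult_strict_right_mono)
  finally have ed: "real n * (real n - 1) < (w - real n + 1) * d" .
  have e0: "0 < w - real n + 1" using w1 by simp
  have \<nu>: "(w - real n + 1) * (d + real n) < (w - real n + 1) * \<nu>"
    using assms e0 by (intro mult_strict_left_mono) (auto simp: d_def)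
  show 1: "real n * w < \<nu> * (w - real n + 1)"
    using \<nu> ed by (simp add: algebra_simps)
  show "(real n - 1) * w < \<nu> * (w - real n + 1)"
    using 1 w0 by (simp add: algebra_simps)
  have "real n * 1 \<le> real n * s" using s1 by (intro mult_left_mono) auto
  then have "real n * real n < (w - real n + 1) * (d + 1)"
    using ed e by (simp add: algebra_simps)
  also have "\<dots> < (w - real n + 1) * (\<nu> - real n + 1)"
    using \<nu> by (simp add: algebra_simps)
  finally show "real n * real n < (w - real n + 1) * (\<nu> - real n + 1)" .
  show "real n * (real n - 1) < (w - real n + 1) * (\<nu> - (real n - 1) + 1)"
    using \<nu> ed e0 by (simp add: algebra_simps)
qed

lemma w_exp_gt_crossing:
  assumes "ereal y < w_hat n \<zeta>"
  shows "ereal (s * y) < w_exp n \<zeta>"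
proof (rule ccontr)
  assume "\<not> ?thesis"
  then have "phi n (w_exp n \<zeta>) \<le> ereal y"
    using n y sum_le by (intro phi_le[where s = s]) auto
  then show False using assms SS by (meson leD order_trans)
qed

text \<open>Between the crossing and the jump there is a \<open>w\<close> attained by irreducible
  \<open>P\<close> of degree exactly \<open>n\<close>; any nonzero multiple of \<open>P\<close> of
  degree at most \<open>n\<close> is a constant multiple.\<close>

lemma w_hat_le_if_jump:
  assumes jump: "w_exp (n - 1) \<zeta> < w_exp n \<zeta>"
  shows "w_hat n \<zeta> \<le> ereal y"
proof (rule ccontr)
  assume "\<not> ?thesis"
  then have gt: "ereal y < w_hat n \<zeta>" by simp
  obtain \<nu> X0 where \<nu>: "y < \<nu>" and
    Q: "\<forall>X\<ge>X0. \<exists>P. P \<noteq> 0 \<and> degree P \<le> n \<and> poly_height P \<le> X \<and> \<bar>rpoly P \<zeta>\<bar> \<le> X powr (-\<nu>)"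
    using w_hat_greaterD[OF gt] by blast
  obtain w where w: "max (ereal (s * y)) (w_exp (n - 1) \<zeta>) < ereal w" "ereal w < w_exp n \<zeta>"
    using ereal_dense2[of "max (ereal (s * y)) (w_exp (n - 1) \<zeta>)" "w_exp n \<zeta>"]
      w_exp_gt_crossing[OF gt] jump by auto
  then have w': "s * y < w" "w_exp (n - 1) \<zeta> < ereal w" by auto
  note b = crossing_bounds[OF w'(1) \<nu>]
  show False
  proof (rule no_uniform_approx[OF tr _ _ b(1) _ _ _ b(3) b(4), where ?X0.0 = X0])
    show "\<exists>P. irreducible P \<and> degree P = n \<and> B \<le> poly_height P \<and> \<bar>rpoly P \<zeta>\<bar> \<le> poly_height P powr (-w)" for B
      using ex_irreducible_approx_degree[OF tr b(2), of "n - 1" B] w' w n by simp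
    show "\<exists>Q. Q \<noteq> 0 \<and> degree Q \<le> n \<and> poly_height Q \<le> X \<and> \<bar>rpoly Q \<zeta>\<bar> \<le> X powr (-\<nu>) \<and>
          (\<forall>P. irreducible P \<longrightarrow> degree P = n \<longrightarrow> P dvd Q \<longrightarrow> \<bar>rpoly P \<zeta>\<bar> \<le> \<bar>rpoly Q \<zeta>\<bar>)"
      if X: "X0 \<le> X" for X
    proof -
      obtain R where R: "R \<noteq> 0" "degree R \<le> n" "poly_height R \<le> X" "\<bar>rpoly R \<zeta>\<bar> \<le> X powr (-\<nu>)"
        using Q X by blast
      moreover have "\<bar>rpoly P \<zeta>\<bar> \<le> \<bar>rpoly R \<zeta>\<bar>" if "degree P = n" "P dvd R" for P
        using that R by (intro abs_rpoly_dvd_same_degree) auto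
      ultimately show ?thesis by blast
    qed
  qed (use n y \<nu> in auto)
qed

lemma w_hat_star_le_if_previous_jump:
  assumes jump: "w_exp (n - 2) \<zeta> < w_exp (n - 1) \<zeta>" and eq: "w_exp (n - 1) \<zeta> = w_exp n \<zeta>"
  shows "w_hat_star n \<zeta> \<le> ereal y"
proof (rule ccontr)
  assume "\<not> ?thesis"
  then have star: "ereal y < w_hat_star n \<zeta>" by simp
  have y0: "0 \<le> y" using y by simp
  have gt: "ereal y < w_hat n \<zeta>" by (rule w_hat_greater_of_star[OF y0 star])
  obtain \<nu> X0 where \<nu>: "y < \<nu>" and
    Q: "\<forall>X\<ge>X0. \<exists>Q. irreducible Q \<and> degree Q \<le> n \<and> poly_height Q \<le> X \<and> \<bar>rpoly Q \<zeta>\<bar> \<le> X powr (-\<nu>)"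
    using w_hat_star_greaterD[OF y0 star] by blast
  \<comment> \<open>The equality \<open>eq\<close> moves the lower bound \<open>s * y\<close> from
    \<open>w_exp n \<zeta>\<close> to \<open>w_exp (n - 1) \<zeta>\<close>, so \<open>P\<close> may
    be taken of degree \<open>n - 1\<close>.\<close>
  obtain w where w: "max (ereal (s * y)) (w_exp (n - 2) \<zeta>) < ereal w" "ereal w < w_exp (n - 1) \<zeta>"
    using ereal_dense2[of "max (ereal (s * y)) (w_exp (n - 2) \<zeta>)" "w_exp (n - 1) \<zeta>"]
      w_exp_gt_crossing[OF gt] jump eq by auto
  then have w': "s * y < w" "w_exp (n - 2) \<zeta> < ereal w" by auto
  note b = crossing_bounds[OF w'(1) \<nu>]
  have S: "Suc (n - 2) = n - 1" using n by simp
  have r: "real (n - 1) = real n - 1" using n by simp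
  show False
  proof (rule no_uniform_approx[OF tr _ _ b(1), where ?X0.0 = X0 and p = "n - 1" and \<nu> = \<nu>])
    show "\<exists>P. irreducible P \<and> degree P = n - 1 \<and> B \<le> poly_height P \<and> \<bar>rpoly P \<zeta>\<bar> \<le> poly_height P powr (-w)" for B
      using ex_irreducible_approx_degree[OF tr b(2), of "n - 2" B] w' w unfolding S by simp
    show "\<exists>Q. Q \<noteq> 0 \<and> degree Q \<le> n \<and> poly_height Q \<le> X \<and> \<bar>rpoly Q \<zeta>\<bar> \<le> X powr (-\<nu>) \<and>
          (\<forall>P. irreducible P \<longrightarrow> degree P = n - 1 \<longrightarrow> P dvd Q \<longrightarrow> \<bar>rpoly P \<zeta>\<bar> \<le> \<bar>rpoly Q \<zeta>\<bar>)"
      if X: "X0 \<le> X" for X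
    proof -
      obtain R where R: "irreducible R" "degree R \<le> n" "poly_height R \<le> X" "\<bar>rpoly R \<zeta>\<bar> \<le> X powr (-\<nu>)"
        using Q X by blast
      moreover have "R \<noteq> 0" using R by auto
      moreover have "\<bar>rpoly P \<zeta>\<bar> \<le> \<bar>rpoly R \<zeta>\<bar>" if "irreducible P" "degree P = n - 1" "P dvd R" for P
        using that R(1) n by (intro abs_rpoly_dvd_irreducible) auto
      ultimately show ?thesis by blast
    qed
    show "real (n - 1) * w < \<nu> * (w - real n + 1)" using b(6) by (simp only: r)
    show "real (n - 1) * real n < (w - real n + 1) * (\<nu> - real (n - 1) + 1)"
      using b(5) by (simp only: r mult.commute)
  qed (use n y \<nu> in auto)
qed

end

lemma w_hat_le_if_equal:
  assumes "\<not> algebraic \<zeta>" "1 \<le> m" "1 \<le> n" "w_exp m \<zeta> = w_exp n \<zeta>"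
  shows "w_hat n \<zeta> \<le> ereal (real m + real n - 1)"
  using assms w_hat_le_w_exp[of n \<zeta>] by (intro w_hat_le_of_w_hat_le_w_exp) auto

theorem theorem3p1:
  assumes SS: "\<forall>n::nat. \<forall>\<zeta>::real. n \<ge> 2 \<and> \<not> algebraic \<zeta> \<longrightarrow>
                 w_hat n \<zeta> \<le> phi n (w_exp n \<zeta>)"
  shows "(\<forall>\<epsilon>>0. \<exists>n0::nat. \<forall>\<zeta>::real. \<forall>n::nat. \<not> algebraic \<zeta> \<and> n \<ge> n0 \<longrightarrow>
             w_hat_star n \<zeta> \<le> ereal (2 * real n - Delta + \<epsilon>))
       \<and> (\<forall>\<epsilon>>0. \<exists>n0::nat. \<forall>\<zeta>::real. \<forall>n::nat. \<not> algebraic \<zeta> \<and> n \<ge> n0 \<longrightarrow>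
             \<not> (w_exp (n - 2) \<zeta> < w_exp (n - 1) \<zeta> \<and> w_exp (n - 1) \<zeta> = w_exp n \<zeta>) \<longrightarrow>
             w_hat n \<zeta> \<le> ereal (2 * real n - Delta + \<epsilon>))
       \<and> (\<forall>\<zeta>::real. \<forall>n::nat. \<not> algebraic \<zeta> \<and> n \<ge> 10 \<longrightarrow>
             w_hat n \<zeta> \<le> ereal (2 * real n - 2))"
proof -
  have asymptotic: "\<exists>n0. \<forall>\<zeta>::real. \<forall>n. \<not> algebraic \<zeta> \<and> n \<ge> n0 \<longrightarrow>
      w_hat_star n \<zeta> \<le> ereal (2 * real n - Delta + \<epsilon>) \<and>
      (\<not> (w_exp (n - 2) \<zeta> < w_exp (n - 1) \<zeta> \<and> w_exp (n - 1) \<zeta> = w_exp n \<zeta>) \<longrightarrow>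
        w_hat n \<zeta> \<le> ereal (2 * real n - Delta + \<epsilon>))" if \<epsilon>: "0 < \<epsilon>" for \<epsilon>
  proof -
    define c where "c = Delta - 1"
    \<comment> \<open>Just below \<open>c\<close>, so that \<open>exp a < 1 + 2 * a\<close> is
      strict; \<open>c / 2\<close> keeps \<open>a\<close> positive for large
      \<open>\<epsilon>\<close>.\<close>
    define a where "a = max (c - \<epsilon>) (c / 2)"
    have c: "exp c = 1 + 2 * c" "0 < c" "c < 2"
      using Delta_properties by (auto simp: c_def)
    have a: "0 < a" "a < c" using \<epsilon> c by (auto simp: a_def)
    have "exp a < 1 + 2 * a" using exp_less_1_plus_double[OF c(1) a] .
    then obtain n1 where n1: "\<And>n. n1 \<le> n \<Longrightarrow>
        (\<Sum>j<n. ((real n - 1) / (real n - 1 - a)) ^ j) \<le> 2 * real n - 1 - a"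
      using eventually_geometric_sum_le[OF a(1)] unfolding eventually_sequentially by blast
    show ?thesis
    proof (intro exI[of _ "max n1 4"] allI impI)
      fix \<zeta> :: real and n :: nat
      assume "\<not> algebraic \<zeta> \<and> max n1 4 \<le> n"
      then have tr: "\<not> algebraic \<zeta>" and n: "n1 \<le> n" "4 \<le> n" by auto
      define y where "y = 2 * real n - 1 - a"
      have yle: "ereal y \<le> ereal (2 * real n - Delta + \<epsilon>)"
        using a_def by (simp add: y_def c_def)
      have y: "real n < y" "y \<le> 2 * real n - 1" using a c n by (auto simp: y_def)
      have s: "(real n - 1) / (y - real n) = (real n - 1) / (real n - 1 - a)"
        by (simp add: y_def algebra_simps)
      have sum: "(\<Sum>j<n. ((real n - 1) / (y - real n)) ^ j) \<le> y"
        unfolding s using n1[OF n(1)] by (simp add: y_def)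
      have SSn: "w_hat n \<zeta> \<le> phi n (w_exp n \<zeta>)" and n2: "2 \<le> n" using SS tr n by auto
      note jump = w_hat_le_if_jump[OF tr n2 y refl sum SSn]
      note star = w_hat_star_le_if_previous_jump[OF tr n2 y refl sum SSn]
      have mono: "w_exp (n - 2) \<zeta> \<le> w_exp (n - 1) \<zeta>" "w_exp (n - 1) \<zeta> \<le> w_exp n \<zeta>"
        by (intro w_exp_mono; simp)+
      have hat: "w_hat n \<zeta> \<le> ereal y"
        if "\<not> (w_exp (n - 2) \<zeta> < w_exp (n - 1) \<zeta> \<and> w_exp (n - 1) \<zeta> = w_exp n \<zeta>)"
      proof (cases "w_exp (n - 1) \<zeta> < w_exp n \<zeta>")
        case False
        \<comment> \<open>Without a jump at \<open>n\<close>, and outside the exceptional case, all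
          three exponents agree. The resulting bound \<open>2 * n - 3\<close> lies below
          \<open>y\<close> since \<open>a < 2\<close>.\<close>
        then have "w_exp (n - 2) \<zeta> = w_exp n \<zeta>" using that mono by auto
        then have "w_hat n \<zeta> \<le> ereal (real (n - 2) + real n - 1)"
          using tr n by (intro w_hat_le_if_equal) auto
        also have "\<dots> \<le> ereal y" using n a c by (simp add: y_def)
        finally show ?thesis .
      qed (rule jump)
      have "w_hat_star n \<zeta> \<le> ereal y"
      proof (cases "w_exp (n - 2) \<zeta> < w_exp (n - 1) \<zeta> \<and> w_exp (n - 1) \<zeta> = w_exp n \<zeta>")
        case False
        have "0 \<le> y" using y by simp
        then show ?thesis
          using w_hat_greater_of_star[of y n \<zeta>] hat[OF False] by (meson leD leI)
      qed (use star in blast)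
      then show "w_hat_star n \<zeta> \<le> ereal (2 * real n - Delta + \<epsilon>) \<and>
          (\<not> (w_exp (n - 2) \<zeta> < w_exp (n - 1) \<zeta> \<and> w_exp (n - 1) \<zeta> = w_exp n \<zeta>) \<longrightarrow>
          w_hat n \<zeta> \<le> ereal (2 * real n - Delta + \<epsilon>))"
        using hat yle order_trans by blast
    qed
  qed
  moreover have "w_hat n \<zeta> \<le> ereal (2 * real n - 2)"
    if tr: "\<not> algebraic \<zeta>" and n: "10 \<le> n" for \<zeta> :: real and n :: nat
  proof (cases "w_exp (n - 1) \<zeta> < w_exp n \<zeta>")
    case True
    have s: "(real n - 1) / (2 * real n - 2 - real n) = (real n - 1) / (real n - 2)" by simp
    show ?thesis
    proof (rule w_hat_le_if_jump[OF tr _ _ _ refl _ _ True])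
      show "(\<Sum>j<n. ((real n - 1) / (2 * real n - 2 - real n)) ^ j) \<le> 2 * real n - 2"
        unfolding s by (rule geometric_sum_le_2n_minus_2[OF n])
    qed (use SS tr n in auto)
  next
    case False
    then have "w_exp (n - 1) \<zeta> = w_exp n \<zeta>"
      using w_exp_mono[of "n - 1" n \<zeta>] by auto
    \<comment> \<open>With \<open>m = n - 1\<close> the bound is exactly
      \<open>2 * n - 2\<close>.\<close>
    then have "w_hat n \<zeta> \<le> ereal (real (n - 1) + real n - 1)"
      using tr n by (intro w_hat_le_if_equal) auto
    then show ?thesis using n by simp
  qed
  ultimately show ?thesis by blast
qed

end
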